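(* Let $R$ be a standard graded algebra over a field $k$ and $M\in \mathsf{D}^{\mathsf f}_{\mathsf b}(\mathsf{Gr}\,R)$. Then $\operatorname{reg} M=\operatorname{exreg}_R M$, that is, $$\sup\{i+j: H^i_{\mathfrak m}(M)_j\neq 0\}=\sup\{i+j:\operatorname{Ext}^i_R(k,M)_j\neq 0\}.$$
   Context: A standard graded $k$-algebra $R$ is a commutative $\mathbb{N}$-graded ring with $R_0=k$, generated over $k$ by finitely many elements of degree $1$; $\mathfrak m$ is its graded maximal ideal, and $k=R/\mathfrak m$. Modules are graded and morphisms preserve degree. Complexes are indexed homologically. $\mathsf{D}^{\mathsf f}_{\mathsf b}(\mathsf{Gr}\,R)$ is the full subcategory of the derived category of graded $R$-modules consisting of complexes $M$ with every $H_i(M)$ finitely generated and $H_i(M)=0$ for $|i|\gg 0$. $H^i_{\mathfrak m}(M)=H_{-i}(\mathsf R\Gamma_{\mathfrak m}(M))$ is local cohomology, $\operatorname{Ext}^i_R(k,M)=H_{-i}(\mathsf R\mathrm{Hom}_R(k,M))$ (graded Ext). $\operatorname{reg} M$ and $\operatorname{exreg}_R M$ denote the left and right suprema respectively; both are $-\infty$ if $M\simeq 0$. *)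

theory Defs
  imports "HOL-Algebra.Module" "HOL-Algebra.Generated_Rings" "HOL-Algebra.Ideal_Product"
    "HOL-Library.Extended_Real"
begin

section \<open>Standard graded algebras\<close>

definition is_grading :: "('b, 'c) ring_scheme \<Rightarrow> ('i \<Rightarrow> 'b set) \<Rightarrow> bool" where
  "is_grading G N \<longleftrightarrow>
     (\<forall>i. additive_subgroup (N i) G) \<and>
     (\<forall>x\<in>carrier G. \<exists>!c. (\<forall>i. c i \<in> N i) \<and> finite {i. c i \<noteq> \<zero>\<^bsub>G\<^esub>} \<and>
        x = (\<Oplus>\<^bsub>G\<^esub>i\<in>{i. c i \<noteq> \<zero>\<^bsub>G\<^esub>}. c i))"

definition standard_graded_algebra :: "'r set \<Rightarrow> 'r ring \<Rightarrow> (nat \<Rightarrow> 'r set) \<Rightarrow> bool" where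
  "standard_graded_algebra k R G \<longleftrightarrow>
     cring R \<and> is_grading R G \<and>
     (\<forall>a b. \<forall>r\<in>G a. \<forall>s\<in>G b. r \<otimes>\<^bsub>R\<^esub> s \<in> G (a + b)) \<and>
     subfield k R \<and> G 0 = k \<and>
     (\<exists>X. finite X \<and> X \<subseteq> G 1 \<and> generate_ring R (k \<union> X) = carrier R)"

definition irrelevant_ideal :: "'r ring \<Rightarrow> (nat \<Rightarrow> 'r set) \<Rightarrow> 'r set" where
  "irrelevant_ideal R G = Idl\<^bsub>R\<^esub> (\<Union>a\<in>{1..}. G a)"


section \<open>Graded modules\<close>

text \<open>Modules are those of HOL-Algebra (the ring fields \<open>mult\<close> and \<open>one\<close> of a module record carry
  no information); \<open>hcomp N j\<close> is the homogeneous component of \<open>N\<close> of degree \<open>j\<close>.\<close>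

record ('r, 'm) gmodule = "('r, 'm) module" +
  hcomp :: "int \<Rightarrow> 'm set"

definition graded_module :: "'r ring \<Rightarrow> (nat \<Rightarrow> 'r set) \<Rightarrow> ('r, 'm) gmodule \<Rightarrow> bool" where
  "graded_module R G N \<longleftrightarrow>
     module R N \<and> is_grading N (hcomp N) \<and>
     (\<forall>a j. \<forall>r\<in>G a. \<forall>x\<in>hcomp N j. r \<odot>\<^bsub>N\<^esub> x \<in> hcomp N (int a + j))"

definition fin_gen :: "'r ring \<Rightarrow> ('r, 'm) gmodule \<Rightarrow> bool" where
  "fin_gen R N \<longleftrightarrow>
     (\<exists>S. finite S \<and> S \<subseteq> carrier N \<and> (\<forall>H. submodule H R N \<and> S \<subseteq> H \<longrightarrow> H = carrier N))"

definition mod_hom :: "'r ring \<Rightarrow> ('r, 'a) gmodule \<Rightarrow> ('r, 'b) gmodule \<Rightarrow> ('a \<Rightarrow> 'b) set" where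
  "mod_hom R A B = {f \<in> carrier A \<rightarrow> carrier B.
     (\<forall>x\<in>carrier A. \<forall>y\<in>carrier A. f (x \<oplus>\<^bsub>A\<^esub> y) = f x \<oplus>\<^bsub>B\<^esub> f y) \<and>
     (\<forall>r\<in>carrier R. \<forall>x\<in>carrier A. f (r \<odot>\<^bsub>A\<^esub> x) = r \<odot>\<^bsub>B\<^esub> f x)}"

text \<open>Linear maps that are homogeneous of degree \<open>j\<close>; morphisms in \<open>Gr R\<close> are those with
  \<open>j = 0\<close>.\<close>

definition gmod_hom ::
  "'r ring \<Rightarrow> ('r, 'a) gmodule \<Rightarrow> ('r, 'b) gmodule \<Rightarrow> int \<Rightarrow> ('a \<Rightarrow> 'b) set" where
  "gmod_hom R A B j = {f \<in> mod_hom R A B. \<forall>a. f ` hcomp A a \<subseteq> hcomp B (a + j)}"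

definition sub_gmodule :: "('r, 'm) gmodule \<Rightarrow> 'm set \<Rightarrow> ('r, 'm) gmodule" where
  "sub_gmodule N H = N\<lparr>carrier := H, hcomp := (\<lambda>j. hcomp N j \<inter> H)\<rparr>"

definition quot_gmodule :: "('r, 'm) gmodule \<Rightarrow> 'm set \<Rightarrow> ('r, 'm set) gmodule" where
  "quot_gmodule N H =
     \<lparr>carrier = a_rcosets\<^bsub>N\<^esub> H, mult = (\<lambda>_ _. H), one = H, zero = H, add = set_add N,
      smult = (\<lambda>r X. \<Union>x\<in>X. H +>\<^bsub>N\<^esub> (r \<odot>\<^bsub>N\<^esub> x)),
      hcomp = (\<lambda>j. (\<lambda>x. H +>\<^bsub>N\<^esub> x) ` hcomp N j)\<rparr>"

definition ring_gmodule :: "'r ring \<Rightarrow> (nat \<Rightarrow> 'r set) \<Rightarrow> ('r, 'r) gmodule" where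
  "ring_gmodule R G =
     \<lparr>carrier = carrier R, mult = mult R, one = one R, zero = zero R, add = add R,
      smult = mult R, hcomp = (\<lambda>j. if j \<ge> 0 then G (nat j) else {\<zero>\<^bsub>R\<^esub>})\<rparr>"

definition residue_field :: "'r ring \<Rightarrow> (nat \<Rightarrow> 'r set) \<Rightarrow> ('r, 'r set) gmodule" where
  "residue_field R G = quot_gmodule (ring_gmodule R G) (irrelevant_ideal R G)"

definition torsion_submodule ::
  "'r ring \<Rightarrow> (nat \<Rightarrow> 'r set) \<Rightarrow> ('r, 'm) gmodule \<Rightarrow> ('r, 'm) gmodule" where
  "torsion_submodule R G N = sub_gmodule N
     {x \<in> carrier N. \<exists>n::nat. \<forall>r \<in> irrelevant_ideal R G [^]\<^bsub>ideals_set R\<^esub> n. r \<odot>\<^bsub>N\<^esub> x = \<zero>\<^bsub>N\<^esub>}"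

text \<open>The graded Hom module: the direct sum over all \<open>j\<close> of the groups of homogeneous maps of
  degree \<open>j\<close>. Maps are taken to be \<open>undefined\<close> outside \<open>carrier A\<close>, so that equality of maps
  is equality of HOL functions.\<close>

definition graded_Hom ::
  "'r ring \<Rightarrow> ('r, 'a) gmodule \<Rightarrow> ('r, 'b) gmodule \<Rightarrow> ('r, 'a \<Rightarrow> 'b) gmodule" where
  "graded_Hom R A B =
     \<lparr>carrier = {f \<in> extensional (carrier A).
        \<exists>J c. finite J \<and> (\<forall>j\<in>J. c j \<in> gmod_hom R A B j) \<and>
              (\<forall>x\<in>carrier A. f x = (\<Oplus>\<^bsub>B\<^esub>j\<in>J. c j x))},
      mult = (\<lambda>_ _. \<lambda>x\<in>carrier A. \<zero>\<^bsub>B\<^esub>), one = (\<lambda>x\<in>carrier A. \<zero>\<^bsub>B\<^esub>),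
      zero = (\<lambda>x\<in>carrier A. \<zero>\<^bsub>B\<^esub>),
      add = (\<lambda>f g. \<lambda>x\<in>carrier A. f x \<oplus>\<^bsub>B\<^esub> g x),
      smult = (\<lambda>r f. \<lambda>x\<in>carrier A. r \<odot>\<^bsub>B\<^esub> f x),
      hcomp = (\<lambda>j. gmod_hom R A B j \<inter> extensional (carrier A))\<rparr>"

text \<open>Injective objects of \<open>Gr R\<close>. HOL cannot quantify over types inside a definition, so the
  test modules \<open>A\<close>, \<open>B\<close> range over the type \<open>nat \<Rightarrow> 'r + 'e\<close>. This loses nothing: the type
  contains copies of \<open>R\<close> with all its degree shifts and of all homogeneous ideals, and by
  the graded form of Baer's criterion extension along those inclusions already implies extension
  along every monomorphism of graded modules.\<close>

definition injective_gmodule ::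
  "'r ring \<Rightarrow> (nat \<Rightarrow> 'r set) \<Rightarrow> ('r, 'e) gmodule \<Rightarrow> bool" where
  "injective_gmodule R G E \<longleftrightarrow>
     graded_module R G E \<and>
     (\<forall>(A :: ('r, nat \<Rightarrow> 'r + 'e) gmodule) (B :: ('r, nat \<Rightarrow> 'r + 'e) gmodule) f g.
        graded_module R G A \<and> graded_module R G B \<and>
        f \<in> gmod_hom R A B 0 \<and> inj_on f (carrier A) \<and> g \<in> gmod_hom R A E 0 \<longrightarrow>
        (\<exists>h \<in> gmod_hom R B E 0. \<forall>x\<in>carrier A. h (f x) = g x))"


section \<open>Complexes of graded modules\<close>

text \<open>Homological indexing: \<open>diff X n\<close> is the differential from \<open>obj X n\<close> to \<open>obj X (n - 1)\<close>.\<close>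

record ('r, 'm) gcomplex =
  obj :: "int \<Rightarrow> ('r, 'm) gmodule"
  diff :: "int \<Rightarrow> 'm \<Rightarrow> 'm"

definition graded_complex :: "'r ring \<Rightarrow> (nat \<Rightarrow> 'r set) \<Rightarrow> ('r, 'm) gcomplex \<Rightarrow> bool" where
  "graded_complex R G X \<longleftrightarrow>
     (\<forall>n. graded_module R G (obj X n) \<and> diff X n \<in> gmod_hom R (obj X n) (obj X (n - 1)) 0 \<and>
        (\<forall>x\<in>carrier (obj X n). diff X (n - 1) (diff X n x) = \<zero>\<^bsub>obj X (n - 2)\<^esub>))"

definition cycles :: "('r, 'm) gcomplex \<Rightarrow> int \<Rightarrow> 'm set" where
  "cycles X n = {x \<in> carrier (obj X n). diff X n x = \<zero>\<^bsub>obj X (n - 1)\<^esub>}"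

definition boundaries :: "('r, 'm) gcomplex \<Rightarrow> int \<Rightarrow> 'm set" where
  "boundaries X n = diff X (n + 1) ` carrier (obj X (n + 1))"

definition homology :: "('r, 'm) gcomplex \<Rightarrow> int \<Rightarrow> ('r, 'm set) gmodule" where
  "homology X n = quot_gmodule (sub_gmodule (obj X n) (cycles X n)) (boundaries X n)"

definition Dfb :: "'r ring \<Rightarrow> (nat \<Rightarrow> 'r set) \<Rightarrow> ('r, 'm) gcomplex set" where
  "Dfb R G = {M. graded_complex R G M \<and> (\<forall>n. fin_gen R (homology M n)) \<and>
     (\<exists>b. \<forall>n. \<bar>n\<bar> > b \<longrightarrow> carrier (homology M n) = {\<zero>\<^bsub>homology M n\<^esub>})}"

definition chain_map ::
  "'r ring \<Rightarrow> ('r, 'a) gcomplex \<Rightarrow> ('r, 'b) gcomplex \<Rightarrow> (int \<Rightarrow> 'a \<Rightarrow> 'b) \<Rightarrow> bool" where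
  "chain_map R X Y f \<longleftrightarrow>
     (\<forall>n. f n \<in> gmod_hom R (obj X n) (obj Y n) 0 \<and>
        (\<forall>x\<in>carrier (obj X n). f (n - 1) (diff X n x) = diff Y n (f n x)))"

definition homology_map ::
  "('r, 'b) gcomplex \<Rightarrow> (int \<Rightarrow> 'a \<Rightarrow> 'b) \<Rightarrow> int \<Rightarrow> 'a set \<Rightarrow> 'b set" where
  "homology_map Y f n C = (\<Union>x\<in>C. boundaries Y n +>\<^bsub>obj Y n\<^esub> f n x)"

definition quasi_iso ::
  "'r ring \<Rightarrow> ('r, 'a) gcomplex \<Rightarrow> ('r, 'b) gcomplex \<Rightarrow> (int \<Rightarrow> 'a \<Rightarrow> 'b) \<Rightarrow> bool" where
  "quasi_iso R X Y f \<longleftrightarrow>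
     chain_map R X Y f \<and>
     (\<forall>n. bij_betw (homology_map Y f n) (carrier (homology X n)) (carrier (homology Y n)))"

text \<open>Every complex with homology bounded above admits such a resolution (truncate, then
  resolve), and up to isomorphism one with carrier type \<open>nat \<Rightarrow> 'm\<close>: a graded vector space \<open>V\<close>
  embeds in the cofree graded module with components
  \<open>\<Prod>a. Hom\<^sub>k (R\<^sub>a, V\<^sub>j\<^sub>+\<^sub>a)\<close>, whose elements are sequences of finite tuples in \<open>V\<close>.\<close>

definition injective_resolution ::
  "'r ring \<Rightarrow> (nat \<Rightarrow> 'r set) \<Rightarrow> ('r, 'm) gcomplex \<Rightarrow> ('r, 'e) gcomplex \<Rightarrow> (int \<Rightarrow> 'm \<Rightarrow> 'e) \<Rightarrow> bool"
  where
  "injective_resolution R G M I \<eta> \<longleftrightarrow>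
     graded_complex R G I \<and> (\<forall>n. injective_gmodule R G (obj I n)) \<and>
     (\<exists>b. \<forall>n>b. carrier (obj I n) = {\<zero>\<^bsub>obj I n\<^esub>}) \<and>
     quasi_iso R M I \<eta>"


section \<open>Local cohomology, Ext and the two regularities\<close>

text \<open>The derived functors of \<open>M\<close> are computed as usual by applying the functor to an injective
  resolution of \<open>M\<close>: in what follows, \<open>I\<close> is such a resolution.\<close>

definition Gamma_complex ::
  "'r ring \<Rightarrow> (nat \<Rightarrow> 'r set) \<Rightarrow> ('r, 'e) gcomplex \<Rightarrow> ('r, 'e) gcomplex" where
  "Gamma_complex R G I = \<lparr>obj = (\<lambda>n. torsion_submodule R G (obj I n)), diff = diff I\<rparr>"

definition Hom_complex ::
  "'r ring \<Rightarrow> ('r, 'a) gmodule \<Rightarrow> ('r, 'e) gcomplex \<Rightarrow> ('r, 'a \<Rightarrow> 'e) gcomplex" where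
  "Hom_complex R A I =
     \<lparr>obj = (\<lambda>n. graded_Hom R A (obj I n)),
      diff = (\<lambda>n f. \<lambda>x\<in>carrier A. diff I n (f x))\<rparr>"

definition local_cohomology ::
  "'r ring \<Rightarrow> (nat \<Rightarrow> 'r set) \<Rightarrow> ('r, 'e) gcomplex \<Rightarrow> int \<Rightarrow> ('r, 'e set) gmodule" where
  "local_cohomology R G I i = homology (Gamma_complex R G I) (- i)"

definition Ext ::
  "'r ring \<Rightarrow> ('r, 'a) gmodule \<Rightarrow> ('r, 'e) gcomplex \<Rightarrow> int \<Rightarrow> ('r, ('a \<Rightarrow> 'e) set) gmodule" where
  "Ext R A I i = homology (Hom_complex R A I) (- i)"

definition reg :: "'r ring \<Rightarrow> (nat \<Rightarrow> 'r set) \<Rightarrow> ('r, 'e) gcomplex \<Rightarrow> ereal" where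
  "reg R G I = Sup {ereal (of_int (i + j)) | i j.
     hcomp (local_cohomology R G I i) j \<noteq> {\<zero>\<^bsub>local_cohomology R G I i\<^esub>}}"

definition exreg :: "'r ring \<Rightarrow> (nat \<Rightarrow> 'r set) \<Rightarrow> ('r, 'e) gcomplex \<Rightarrow> ereal" where
  "exreg R G I = Sup {ereal (of_int (i + j)) | i j.
     hcomp (Ext R (residue_field R G) I i) j \<noteq> {\<zero>\<^bsub>Ext R (residue_field R G) I i\<^esub>}}"

end

theory Submission
  imports Defs "HOL-Algebra.Embedded_Algebras"
begin

text \<open>Let \<open>I\<close> be the injective resolution, \<open>T\<close> its \<open>m\<close>-torsion subcomplex and \<open>S \<subseteq> T\<close> its
  socle subcomplex, so that \<open>H(T)\<close> is local cohomology and \<open>H(S)\<close> is \<open>Ext(k, M)\<close>. Both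
  inequalities come from one descent step. Let \<open>u \<in> I\<^sub>j\<close> be killed by \<open>R\<^sub>a\<close> for all \<open>a > p\<close>, and let
  \<open>R\<^sub>p u\<close> consist of boundaries of \<open>S\<close>. Choose the primitives linearly in \<open>R\<^sub>p\<close> and extend the
  resulting map \<open>R\<^sub>\<ge>\<^sub>p \<rightarrow> I\<close> to \<open>R\<close>: the image \<open>g\<close> of \<open>1\<close> is torsion and \<open>u - dg\<close> is killed by
  \<open>R\<^sub>a\<close> for all \<open>a \<ge> p\<close>.

  If \<open>H\<^sup>i(S)\<^sub>j = 0\<close> for \<open>i + j > r\<close>, the step applies to every cycle of \<open>T\<close> with \<open>i + j > r\<close>, as
  \<open>R\<^sub>p u\<close> has total degree \<open>i + j + p\<close>; iterating it shows that the cycle is a boundary of \<open>T\<close>.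
  Conversely let \<open>H\<^sup>i(T)\<^sub>j = 0\<close> for \<open>i + j > r\<close> and use induction on \<open>i\<close>, which is bounded below. A
  cycle \<open>z \<in> S\<close> is \<open>dw\<close> with \<open>w\<close> in \<open>T\<close>. For \<open>p \<ge> 1\<close> the elements of \<open>R\<^sub>p w\<close> are cycles of
  cohomological degree \<open>i - 1\<close> and internal degree \<open>j + p\<close>, so the induction hypothesis permits the
  step, and \<open>w\<close> is moved into \<open>S\<close> without changing \<open>dw = z\<close>.\<close>

section \<open>Homogeneous components\<close>

definition gcomp :: "('b, 'c) ring_scheme \<Rightarrow> ('i \<Rightarrow> 'b set) \<Rightarrow> 'b \<Rightarrow> 'i \<Rightarrow> 'b" where
  "gcomp A N x = (THE c. (\<forall>i. c i \<in> N i) \<and> finite {i. c i \<noteq> \<zero>\<^bsub>A\<^esub>} \<and>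
     x = (\<Oplus>\<^bsub>A\<^esub>i\<in>{i. c i \<noteq> \<zero>\<^bsub>A\<^esub>}. c i))"

locale graded_group = abelian_group A for A (structure) +
  fixes N :: "'i \<Rightarrow> 'a set"
  assumes grading: "is_grading A N"
begin

lemma component_subgroup: "additive_subgroup (N i) A"
  using grading by (simp add: is_grading_def)

lemma component_carrier: "x \<in> N i \<Longrightarrow> x \<in> carrier A"
  using additive_subgroup.a_Hcarr[OF component_subgroup] .

lemma component_zero: "\<zero> \<in> N i"
  using additive_subgroup.zero_closed[OF component_subgroup] .

lemma component_add: "x \<in> N i \<Longrightarrow> y \<in> N i \<Longrightarrow> x \<oplus> y \<in> N i"
  using additive_subgroup.a_closed[OF component_subgroup] .

lemma component_minus: "x \<in> N i \<Longrightarrow> \<ominus> x \<in> N i"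
  using additive_subgroup.a_inv_closed[OF component_subgroup] by (simp add: abelian_group_axioms)

lemma gcomp_spec:
  assumes "x \<in> carrier A"
  shows "(\<forall>i. gcomp A N x i \<in> N i) \<and> finite {i. gcomp A N x i \<noteq> \<zero>} \<and>
    x = (\<Oplus>i\<in>{i. gcomp A N x i \<noteq> \<zero>}. gcomp A N x i)"
proof -
  have "\<exists>!c. (\<forall>i. c i \<in> N i) \<and> finite {i. c i \<noteq> \<zero>} \<and> x = (\<Oplus>i\<in>{i. c i \<noteq> \<zero>}. c i)"
    using grading assms by (simp add: is_grading_def)
  from theI'[OF this] show ?thesis by (simp add: gcomp_def)
qed

lemma gcomp_in: "x \<in> carrier A \<Longrightarrow> gcomp A N x i \<in> N i"
  using gcomp_spec by blast

lemma gcomp_closed: "x \<in> carrier A \<Longrightarrow> gcomp A N x i \<in> carrier A"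
  using gcomp_in component_carrier by blast

lemma gcomp_finite: "x \<in> carrier A \<Longrightarrow> finite {i. gcomp A N x i \<noteq> \<zero>}"
  using gcomp_spec by blast

lemma gcomp_sum:
  assumes "x \<in> carrier A" "finite F" "{i. gcomp A N x i \<noteq> \<zero>} \<subseteq> F"
  shows "x = (\<Oplus>i\<in>F. gcomp A N x i)"
proof -
  have "(\<Oplus>i\<in>{i. gcomp A N x i \<noteq> \<zero>}. gcomp A N x i) = (\<Oplus>i\<in>F. gcomp A N x i)"
    by (rule add.finprod_mono_neutral_cong_left) (use assms gcomp_closed in auto)
  then show ?thesis using gcomp_spec[OF assms(1)] by simp
qed

text \<open>\<open>is_grading\<close> asserts uniqueness only for sums over the exact support. The
  family is therefore extended by zero outside \<open>F\<close>, and zero summands inside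
  \<open>F\<close> drop out.\<close>

lemma gcomp_eqI:
  assumes "finite F" "\<And>i. i \<in> F \<Longrightarrow> c i \<in> N i" "x = (\<Oplus>i\<in>F. c i)"
  shows "gcomp A N x i = (if i \<in> F then c i else \<zero>)"
proof -
  define c' where "c' = (\<lambda>i. if i \<in> F then c i else \<zero>)"
  have c': "\<forall>i. c' i \<in> N i" using assms(2) component_zero by (simp add: c'_def)
  have sup: "{i. c' i \<noteq> \<zero>} \<subseteq> F" by (auto simp: c'_def)
  have fin: "finite {i. c' i \<noteq> \<zero>}" using sup assms(1) finite_subset by blast
  have "(\<Oplus>i\<in>{i. c' i \<noteq> \<zero>}. c' i) = (\<Oplus>i\<in>F. c i)"
    by (rule add.finprod_mono_neutral_cong_left)
      (use assms(1) sup component_carrier[OF assms(2)] in \<open>auto simp: c'_def\<close>)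
  then have "x = (\<Oplus>i\<in>{i. c' i \<noteq> \<zero>}. c' i)" using assms(3) by simp
  moreover have x: "x \<in> carrier A" using assms component_carrier by (auto intro!: finsum_closed)
  have "\<exists>!c. (\<forall>i. c i \<in> N i) \<and> finite {i. c i \<noteq> \<zero>} \<and> x = (\<Oplus>i\<in>{i. c i \<noteq> \<zero>}. c i)"
    using grading x by (simp add: is_grading_def)
  ultimately have "gcomp A N x = c'"
    using gcomp_spec[OF x] c' fin by blast
  then show ?thesis by (simp add: c'_def)
qed

lemma gcomp_homogeneous:
  assumes "x \<in> N i"
  shows "gcomp A N x l = (if l = i then x else \<zero>)"
proof -
  have "x = (\<Oplus>l\<in>{i}. x)" using component_carrier[OF assms] by simp
  from gcomp_eqI[OF _ _ this, of l] show ?thesis using assms by auto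
qed

lemma gcomp_add:
  assumes x: "x \<in> carrier A" and y: "y \<in> carrier A"
  shows "gcomp A N (x \<oplus> y) i = gcomp A N x i \<oplus> gcomp A N y i"
proof -
  let ?F = "{i. gcomp A N x i \<noteq> \<zero>} \<union> {i. gcomp A N y i \<noteq> \<zero>}"
  have fin: "finite ?F" using gcomp_finite x y by simp
  have "x \<oplus> y = (\<Oplus>i\<in>?F. gcomp A N x i) \<oplus> (\<Oplus>i\<in>?F. gcomp A N y i)"
    using gcomp_sum[OF x fin] gcomp_sum[OF y fin] by simp
  also have "\<dots> = (\<Oplus>i\<in>?F. gcomp A N x i \<oplus> gcomp A N y i)"
    by (rule finsum_addf[symmetric]) (use gcomp_closed x y in auto)
  finally show ?thesis
    using gcomp_eqI[OF fin, of "\<lambda>i. gcomp A N x i \<oplus> gcomp A N y i" "x \<oplus> y" i]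
      gcomp_in x y component_add by (auto split: if_splits)
qed

lemma graded_induct [consumes 1, case_names zero add homogeneous]:
  assumes "x \<in> carrier A" and zero: "P \<zero>"
    and add: "\<And>x y. x \<in> carrier A \<Longrightarrow> y \<in> carrier A \<Longrightarrow> P x \<Longrightarrow> P y \<Longrightarrow> P (x \<oplus> y)"
    and hom: "\<And>i x. x \<in> N i \<Longrightarrow> P x"
  shows "P x"
proof -
  have "P (\<Oplus>i\<in>F. gcomp A N x i)" if "finite F" for F
    using that
  proof (induction F)
    case empty
    then show ?case using zero by simp
  next
    case (insert i F)
    then show ?case
      using add[of "gcomp A N x i" "\<Oplus>i\<in>F. gcomp A N x i"] hom[OF gcomp_in] gcomp_closed assms(1)
      by (simp add: Pi_def)
  qed
  then show ?thesis using gcomp_spec[OF assms(1)] by metis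
qed

end

text \<open>Components are additive, so homogeneous \<open>x\<close> suffice, and injectivity of
  \<open>\<sigma>\<close> keeps distinct degrees apart. For multiplication by a homogeneous scalar
  \<open>\<sigma>\<close> is a translation, for a differential it is the identity. The second
  conclusion serves natural-number degrees, where a translation need not be surjective.\<close>

lemma gcomp_additive_map:
  assumes "graded_group A N" "graded_group B L"
    and x: "x \<in> carrier A"
    and closed: "\<And>x. x \<in> carrier A \<Longrightarrow> \<phi> x \<in> carrier B"
    and add: "\<And>x y. x \<in> carrier A \<Longrightarrow> y \<in> carrier A \<Longrightarrow> \<phi> (x \<oplus>\<^bsub>A\<^esub> y) = \<phi> x \<oplus>\<^bsub>B\<^esub> \<phi> y"
    and shift: "\<And>i x. x \<in> N i \<Longrightarrow> \<phi> x \<in> L (\<sigma> i)"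
    and "inj \<sigma>"
  shows "gcomp B L (\<phi> x) (\<sigma> i) = \<phi> (gcomp A N x i)"
    and "j \<notin> range \<sigma> \<Longrightarrow> gcomp B L (\<phi> x) j = \<zero>\<^bsub>B\<^esub>"
proof -
  interpret A: graded_group A N by fact
  interpret B: graded_group B L by fact
  have "\<phi> \<zero>\<^bsub>A\<^esub> \<oplus>\<^bsub>B\<^esub> \<phi> \<zero>\<^bsub>A\<^esub> = \<phi> \<zero>\<^bsub>A\<^esub>" using add[of "\<zero>\<^bsub>A\<^esub>" "\<zero>\<^bsub>A\<^esub>"] by simp
  then have zero: "\<phi> \<zero>\<^bsub>A\<^esub> = \<zero>\<^bsub>B\<^esub>" using closed[of "\<zero>\<^bsub>A\<^esub>"]
    by (metis A.zero_closed B.add.l_cancel_one')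
  show "gcomp B L (\<phi> x) (\<sigma> i) = \<phi> (gcomp A N x i)"
    using x
  proof (induction x rule: A.graded_induct)
    case zero
    then show ?case
      using A.gcomp_homogeneous[OF A.component_zero, of i i]
        B.gcomp_homogeneous[OF B.component_zero, of "\<sigma> i" "\<sigma> i"] \<open>\<phi> \<zero>\<^bsub>A\<^esub> = \<zero>\<^bsub>B\<^esub>\<close> by simp
  next
    case (add x y)
    then show ?case
      using A.gcomp_add B.gcomp_add A.gcomp_closed closed assms(5) by simp
  next
    case (homogeneous l x)
    then show ?case
      using A.gcomp_homogeneous[OF homogeneous, of i] zero \<open>inj \<sigma>\<close>
        B.gcomp_homogeneous[OF shift[OF homogeneous], of "\<sigma> i"]
      by (auto simp: inj_def)
  qed
  show "gcomp B L (\<phi> x) j = \<zero>\<^bsub>B\<^esub>" if "j \<notin> range \<sigma>"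
    using x
  proof (induction x rule: A.graded_induct)
    case zero
    then show ?case
      using B.gcomp_homogeneous[OF B.component_zero, of j j] \<open>\<phi> \<zero>\<^bsub>A\<^esub> = \<zero>\<^bsub>B\<^esub>\<close> by simp
  next
    case (add x y)
    then show ?case
      using B.gcomp_add closed assms(5) by simp
  next
    case (homogeneous l x)
    then show ?case
      using that B.gcomp_homogeneous[OF shift[OF homogeneous], of j] by auto
  qed
qed

section \<open>Standard graded algebras\<close>

text \<open>The step refers to the span of the whole list although the recursion consumes it: spans
  of tails are contained in it, so no tail has to be tracked.\<close>

lemma (in ring) Span_induct [consumes 3, case_names zero step]:
  assumes "subfield K R" "set Us \<subseteq> carrier R" "v \<in> Span K Us" "P \<zero>"
    and "\<And>c u v. c \<in> K \<Longrightarrow> u \<in> set Us \<Longrightarrow> v \<in> Span K Us \<Longrightarrow> P v \<Longrightarrow> P (c \<otimes> u \<oplus> v)"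
  shows "P v"
  using assms(2,3,5)
proof (induction Us arbitrary: v)
  case Nil
  then show ?case using assms(4) by simp
next
  case (Cons u Us)
  then obtain c w where cw: "c \<in> K" "w \<in> Span K Us" "v = c \<otimes> u \<oplus> w"
    by (auto simp: line_extension_mem_iff)
  have sub: "Span K Us \<subseteq> Span K (u # Us)" using mono_Span[OF assms(1)] Cons.prems by auto
  have "P w" using Cons.IH[OF _ cw(2)] Cons.prems sub by auto
  then show ?case using Cons.prems(3)[of c u w] cw sub by auto
qed

locale std_graded = cring R for R :: "'r ring" (structure) and k :: "'r set" and G :: "nat \<Rightarrow> 'r set" +
  assumes std: "standard_graded_algebra k R G"
begin

sublocale graded_group R G
  using std by unfold_locales (simp add: standard_graded_algebra_def)

lemma subfield_k: "subfield k R" and G_0: "G 0 = k"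
  and G_mult: "r \<in> G a \<Longrightarrow> s \<in> G b \<Longrightarrow> r \<otimes> s \<in> G (a + b)"
  using std by (auto simp: standard_graded_algebra_def)

lemma one_G_0: "\<one> \<in> G 0"
  using subringE(3)[OF subfieldE(1)[OF subfield_k]] G_0 by simp

lemma k_carrier: "c \<in> k \<Longrightarrow> c \<in> carrier R"
  using component_carrier G_0 by auto

text \<open>A list rather than a set, so that products of generators again form lists, as
  \<open>Span\<close> expects.\<close>

definition gens :: "'r list" where
  "gens = (SOME xs. set xs \<subseteq> G 1 \<and> generate_ring R (k \<union> set xs) = carrier R)"

lemma gens: "set gens \<subseteq> G 1" "generate_ring R (k \<union> set gens) = carrier R"
proof -
  obtain X where "finite X" "X \<subseteq> G 1" "generate_ring R (k \<union> X) = carrier R"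
    using std by (auto simp: standard_graded_algebra_def)
  moreover from \<open>finite X\<close> obtain xs where "set xs = X" using finite_list by blast
  ultimately have "\<exists>xs. set xs \<subseteq> G 1 \<and> generate_ring R (k \<union> set xs) = carrier R" by blast
  from someI_ex[OF this] show "set gens \<subseteq> G 1" "generate_ring R (k \<union> set gens) = carrier R"
    by (simp_all add: gens_def)
qed

lemma gens_carrier: "x \<in> set gens \<Longrightarrow> x \<in> carrier R"
  using gens(1) component_carrier by blast

lemma gcomp_mult_homogeneous:
  assumes "r \<in> G a" "t \<in> carrier R"
  shows "gcomp R G (r \<otimes> t) (a + l) = r \<otimes> gcomp R G t l"
    and "j < a \<Longrightarrow> gcomp R G (r \<otimes> t) j = \<zero>"
proof -
  have r: "r \<in> carrier R" using assms component_carrier by blast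
  note map = gcomp_additive_map[OF graded_group_axioms graded_group_axioms assms(2),
      of "\<lambda>t. r \<otimes> t" "\<lambda>l. a + l"]
  show "gcomp R G (r \<otimes> t) (a + l) = r \<otimes> gcomp R G t l"
    by (rule map(1)) (use r assms G_mult in \<open>auto simp: r_distr inj_def\<close>)
  show "gcomp R G (r \<otimes> t) j = \<zero>" if "j < a"
    by (rule map(2)) (use r assms G_mult that in \<open>auto simp: r_distr inj_def\<close>)
qed

section \<open>Monomials in the generators and the graded components\<close>

primrec monomials :: "nat \<Rightarrow> 'r list" where
  "monomials 0 = [\<one>]"
| "monomials (Suc n) = concat (map (\<lambda>x. map (\<lambda>b. x \<otimes> b) (monomials n)) gens)"

lemma monomials_G: "set (monomials n) \<subseteq> G n"
proof (induction n)
  case 0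
  then show ?case using one_G_0 by simp
next
  case (Suc n)
  then show ?case using G_mult[of _ 1 _ n] gens(1) by fastforce
qed

lemma monomials_carrier: "set (monomials n) \<subseteq> carrier R"
  using monomials_G component_carrier by blast

text \<open>A candidate for the component \<open>G n\<close>, with which \<open>G_eq_msp\<close>
  identifies it. The monomials may repeat or be linearly dependent; an independent list is extracted
  later, in \<open>descent\<close>.\<close>

definition msp :: "nat \<Rightarrow> 'r set" where
  "msp n = Span k (monomials n)"

lemma msp_props: "msp n \<subseteq> carrier R" "\<zero> \<in> msp n"
  "\<And>v w. v \<in> msp n \<Longrightarrow> w \<in> msp n \<Longrightarrow> v \<oplus> w \<in> msp n"
  "\<And>v. v \<in> msp n \<Longrightarrow> \<ominus> v \<in> msp n"
  "\<And>c v. c \<in> k \<Longrightarrow> v \<in> msp n \<Longrightarrow> c \<otimes> v \<in> msp n"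
  "set (monomials n) \<subseteq> msp n"
  using Span_subgroup_props[OF subfield_k monomials_carrier]
    Span_smult_closed[OF subfield_k monomials_carrier] Span_base_incl[OF subfield_k monomials_carrier]
  by (auto simp: msp_def)

lemmas msp_induct =
  Span_induct[OF subfield_k monomials_carrier, folded msp_def, consumes 1, case_names zero step]

lemma msp_G: "v \<in> msp n \<Longrightarrow> v \<in> G n"
proof (induction rule: msp_induct)
  case zero
  then show ?case using component_zero .
next
  case (step c u v)
  then show ?case using G_mult[of c 0 u n] monomials_G[of n] G_0 component_add by auto
qed

lemma msp_gens_mult:
  assumes "x \<in> set gens" "v \<in> msp n"
  shows "x \<otimes> v \<in> msp (Suc n)"
  using assms(2)
proof (induction rule: msp_induct)
  case zero
  then show ?case using gens_carrier[OF assms(1)] msp_props(2) by simp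
next
  case (step c u v)
  have carr: "c \<in> carrier R" "u \<in> carrier R" "v \<in> carrier R" "x \<in> carrier R"
    using step k_carrier monomials_carrier gens_carrier assms(1) msp_props(1) by blast+
  have "x \<otimes> u \<in> set (monomials (Suc n))" using assms(1) step by auto
  then have "c \<otimes> (x \<otimes> u) \<oplus> x \<otimes> v \<in> msp (Suc n)"
    using msp_props(3,5,6) step by blast
  moreover have "x \<otimes> (c \<otimes> u \<oplus> v) = c \<otimes> (x \<otimes> u) \<oplus> x \<otimes> v"
    using carr by algebra
  ultimately show ?case by simp
qed

text \<open>Induction on \<open>a\<close> peels one generator off each monomial of the left factor
  and hands it to \<open>msp_gens_mult\<close>; in degree 0 the left factor is a scalar from
  \<open>k\<close>.\<close>

lemma msp_mult:
  assumes "v \<in> msp a" "w \<in> msp b"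
  shows "v \<otimes> w \<in> msp (a + b)"
  using assms(1)
proof (induction a arbitrary: v)
  case 0
  have w: "w \<in> carrier R" using assms msp_props(1) by auto
  from 0 show ?case
  proof (induction rule: msp_induct)
    case zero
    then show ?case using w msp_props(2) by simp
  next
    case (step c u v)
    have carr: "c \<in> carrier R" "v \<in> carrier R" using step k_carrier msp_props(1) by auto
    have "(c \<otimes> u \<oplus> v) \<otimes> w = c \<otimes> w \<oplus> v \<otimes> w"
      using step carr w by (simp add: l_distr)
    then show ?case using step assms(2) msp_props(3,5) by simp
  qed
next
  case (Suc a)
  have w: "w \<in> carrier R" using assms msp_props(1) by auto
  from Suc.prems show ?case
  proof (induction rule: msp_induct)
    case zero
    then show ?case using w msp_props(2) by simp
  next
    case (step c u v)
    then obtain x u' where u: "x \<in> set gens" "u' \<in> set (monomials a)" "u = x \<otimes> u'" by auto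
    have carr: "c \<in> carrier R" "v \<in> carrier R" "x \<in> carrier R" "u' \<in> carrier R"
      using step k_carrier msp_props(1) u gens_carrier monomials_carrier by blast+
    have "u' \<otimes> w \<in> msp (a + b)" using Suc.IH u(2) msp_props(6) by blast
    then have "x \<otimes> (u' \<otimes> w) \<in> msp (Suc a + b)" using msp_gens_mult[OF u(1)] by simp
    then have "c \<otimes> (x \<otimes> (u' \<otimes> w)) \<oplus> v \<otimes> w \<in> msp (Suc a + b)"
      using msp_props(3,5) step by blast
    moreover have "(c \<otimes> u \<oplus> v) \<otimes> w = c \<otimes> (x \<otimes> (u' \<otimes> w)) \<oplus> v \<otimes> w"
      unfolding u(3) using carr w by algebra
    ultimately show ?case by simp
  qed
qed

text \<open>The elements all of whose components are combinations of monomials form a subring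
  \<open>P\<close>. It contains \<open>k\<close> and the generators, hence is all of
  \<open>R\<close>.\<close>

lemma gcomp_msp:
  assumes "r \<in> carrier R"
  shows "gcomp R G r n \<in> msp n"
proof -
  define P where "P = {r \<in> carrier R. \<forall>n. gcomp R G r n \<in> msp n}"
  have add: "r \<oplus> s \<in> P" if "r \<in> P" "s \<in> P" for r s
    using that gcomp_add msp_props(3) by (auto simp: P_def)
  have msp: "r \<in> P" if "r \<in> msp a" for r a
    using that gcomp_homogeneous[OF msp_G[OF that]] msp_props(1,2) by (auto simp: P_def)
  have msp_mult_P: "r \<otimes> s \<in> P" if "r \<in> msp a" "s \<in> P" for r s a
  proof -
    have carr: "r \<in> carrier R" "s \<in> carrier R" using that msp_props(1) by (auto simp: P_def)
    have "gcomp R G (r \<otimes> s) n \<in> msp n" for n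
    proof (cases "n < a")
      case True
      then show ?thesis using gcomp_mult_homogeneous(2)[OF msp_G[OF that(1)] carr(2)] msp_props(2)
        by simp
    next
      case False
      then obtain l where "n = a + l" using le_Suc_ex not_less by blast
      then show ?thesis
        using gcomp_mult_homogeneous(1)[OF msp_G[OF that(1)] carr(2), of l] msp_mult[OF that(1)] that(2)
        by (simp add: P_def)
    qed
    then show ?thesis using carr by (simp add: P_def)
  qed
  \<comment> \<open>Products with a left factor from some \<open>msp a\<close> are settled, since
    such a factor only shifts components. A general left factor is the sum of its components, which
    are of this kind.\<close>
  have mult: "r \<otimes> s \<in> P" if r: "r \<in> P" and s: "s \<in> P" for r s
  proof -
    have carr: "r \<in> carrier R" "s \<in> carrier R" using that by (auto simp: P_def)
    have "(\<Oplus>i\<in>F. gcomp R G r i) \<otimes> s \<in> P" if "finite F" for F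
      using that
    proof (induction F)
      case empty
      then show ?case using carr msp[OF msp_props(2)] by simp
    next
      case (insert i F)
      have "(\<Oplus>i\<in>insert i F. gcomp R G r i) \<otimes> s = gcomp R G r i \<otimes> s \<oplus> (\<Oplus>i\<in>F. gcomp R G r i) \<otimes> s"
        using insert carr gcomp_closed by (simp add: Pi_def l_distr)
      moreover have "gcomp R G r i \<otimes> s \<in> P" using msp_mult_P[OF _ s] r by (auto simp: P_def)
      ultimately show ?case using add insert by simp
    qed
    then show ?thesis using gcomp_spec[OF carr(1)] by metis
  qed
  have one: "\<one> \<in> P" using msp[of \<one> 0] msp_props(6)[of 0] by auto
  have k: "c \<in> P" if "c \<in> k" for c
  proof -
    have "c \<otimes> \<one> \<in> msp 0" using msp_props(5)[OF that, of \<one> 0] msp_props(6)[of 0] by auto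
    then show ?thesis using msp[of c 0] k_carrier[OF that] by simp
  qed
  have gen: "x \<in> P" if "x \<in> set gens" for x
  proof -
    have "x \<in> set (monomials (Suc 0))" using that gens_carrier by force
    then show ?thesis using msp msp_props(6) by blast
  qed
  have "r \<in> generate_ring R (k \<union> set gens)" using assms gens by simp
  then have "r \<in> P"
  proof (induction rule: generate_ring.induct)
    \<comment> \<open>Negation is multiplication by \<open>\<ominus> \<one>\<close>, which lies in
      \<open>msp 0\<close>.\<close>
    case (a_inv h)
    have "\<ominus> \<one> \<in> P" using msp[OF msp_props(4), of \<one> 0] msp_props(6)[of 0] by auto
    then have "\<ominus> \<one> \<otimes> h \<in> P" using mult a_inv by blast
    then show ?case using a_inv l_minus[of \<one> h] by (simp add: P_def)
  qed (use one k gen add mult in auto)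
  then show ?thesis by (simp add: P_def)
qed

text \<open>A homogeneous element is its own component, so \<open>gcomp_msp\<close> gives the
  inclusion opposite to \<open>msp_G\<close>. In particular every \<open>G n\<close> is
  finite-dimensional over \<open>k\<close>.\<close>

lemma G_eq_msp: "G n = msp n"
  using msp_G gcomp_msp[OF component_carrier] gcomp_homogeneous by (metis subsetI subset_antisym)

section \<open>Powers of the irrelevant ideal\<close>

abbreviation mm :: "'r set" where "mm \<equiv> irrelevant_ideal R G"

abbreviation mpow :: "nat \<Rightarrow> 'r set" where "mpow n \<equiv> mm [^]\<^bsub>ideals_set R\<^esub> n"

lemma mm_ideal: "ideal mm R"
  unfolding irrelevant_ideal_def by (rule genideal_ideal) (use component_carrier in auto)

lemma G_mm: "1 \<le> a \<Longrightarrow> r \<in> G a \<Longrightarrow> r \<in> mm"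
  unfolding irrelevant_ideal_def using genideal_self[of "\<Union>a\<in>{1..}. G a"] component_carrier by auto

lemma mpow_0: "mpow 0 = carrier R" and mpow_Suc: "mpow (Suc n) = ideal_prod R (mpow n) mm"
  by (simp_all add: nat_pow_def ideals_set_def)

lemma mpow_ideal: "ideal (mpow n) R"
  by (induction n) (simp_all only: mpow_0 mpow_Suc oneideal ideal_prod_is_ideal mm_ideal)

text \<open>Each generator lies in \<open>mm\<close>. Once \<open>n\<close> of the \<open>a\<close>
  factors have been used, the remaining ones are absorbed by \<open>mpow 0\<close>, the whole
  ring.\<close>

lemma monomials_mpow: "n \<le> a \<Longrightarrow> u \<in> set (monomials a) \<Longrightarrow> u \<in> mpow n"
proof (induction a arbitrary: n u)
  case 0
  then show ?case using mpow_0 by (simp add: nat_pow_def)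
next
  case (Suc a)
  show ?case
  proof (cases n)
    case 0
    then show ?thesis using Suc monomials_carrier mpow_0 by blast
  next
    case (Suc n')
    obtain x b where xb: "x \<in> set gens" "b \<in> set (monomials a)" "u = x \<otimes> b" using Suc.prems by auto
    have "b \<in> mpow n'" using Suc.IH[OF _ xb(2)] Suc.prems Suc by simp
    moreover have "x \<in> mm" using G_mm[of 1] xb gens(1) by auto
    moreover have "u = b \<otimes> x" using xb gens_carrier monomials_carrier m_comm by blast
    ultimately show ?thesis unfolding Suc mpow_Suc by (simp add: ideal_prod.prod)
  qed
qed

text \<open>This rests on generation in degree one: in a polynomial ring on one variable of degree
  2, the component of degree 2 is not contained in the square of the irrelevant ideal.\<close>

lemma G_mpow:
  assumes "n \<le> a" "r \<in> G a"
  shows "r \<in> mpow n"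
proof -
  interpret I: ideal "mpow n" R by (rule mpow_ideal)
  have "r \<in> msp a" using assms G_eq_msp by simp
  then show ?thesis
    by (induction rule: msp_induct) (use monomials_mpow assms k_carrier I.I_l_closed I.a_closed in auto)
qed

end

section \<open>Annihilators of powers of the irrelevant ideal\<close>

text \<open>For a standard graded algebra this is the annihilator of \<open>mpow n\<close> in
  \<open>N\<close>, see \<open>ann_iff_mpow\<close>. The description by degrees lets the descent
  remove one degree at a time. Level 0 is zero and level 1 is the socle.\<close>

definition ann :: "(nat \<Rightarrow> 'r set) \<Rightarrow> ('r, 'm) gmodule \<Rightarrow> nat \<Rightarrow> 'm set" where
  "ann G N n = {x \<in> carrier N. \<forall>a\<ge>n. \<forall>r\<in>G a. r \<odot>\<^bsub>N\<^esub> x = \<zero>\<^bsub>N\<^esub>}"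

locale std_graded_module = std_graded R k G + N: module R N
  for R :: "'r ring" (structure) and k and G and N :: "('r, 'm) gmodule" +
  assumes gm: "graded_module R G N"
begin

sublocale N: graded_group N "hcomp N"
  using gm by unfold_locales (simp add: graded_module_def)

lemma G_smult: "r \<in> G a \<Longrightarrow> x \<in> hcomp N j \<Longrightarrow> r \<odot>\<^bsub>N\<^esub> x \<in> hcomp N (int a + j)"
  using gm by (simp add: graded_module_def)

lemma gcomp_smult:
  assumes "r \<in> G a" "x \<in> carrier N"
  shows "gcomp N (hcomp N) (r \<odot>\<^bsub>N\<^esub> x) (int a + l) = r \<odot>\<^bsub>N\<^esub> gcomp N (hcomp N) x l"
  by (rule gcomp_additive_map(1)[OF N.graded_group_axioms N.graded_group_axioms assms(2)])
    (use assms component_carrier G_smult in \<open>auto simp: N.smult_r_distr inj_def\<close>)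

lemma annI:
  "x \<in> carrier N \<Longrightarrow> (\<And>a r. n \<le> a \<Longrightarrow> r \<in> G a \<Longrightarrow> r \<odot>\<^bsub>N\<^esub> x = \<zero>\<^bsub>N\<^esub>) \<Longrightarrow> x \<in> ann G N n"
  by (simp add: ann_def)

lemma annD: "x \<in> ann G N n \<Longrightarrow> n \<le> a \<Longrightarrow> r \<in> G a \<Longrightarrow> r \<odot>\<^bsub>N\<^esub> x = \<zero>\<^bsub>N\<^esub>"
  by (simp add: ann_def)

lemma ann_carrier: "x \<in> ann G N n \<Longrightarrow> x \<in> carrier N"
  by (simp add: ann_def)

lemma ann_mono: "x \<in> ann G N n \<Longrightarrow> n \<le> n' \<Longrightarrow> x \<in> ann G N n'"
  by (meson annI annD ann_carrier le_trans)

lemma ann_smult: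
  assumes "r \<in> carrier R" "x \<in> ann G N n"
  shows "r \<odot>\<^bsub>N\<^esub> x \<in> ann G N n"
proof (rule annI)
  show "r \<odot>\<^bsub>N\<^esub> x \<in> carrier N" using assms ann_carrier by simp
  fix a s assume s: "n \<le> a" "s \<in> G a"
  then have carr: "s \<in> carrier R" "x \<in> carrier N" using component_carrier assms ann_carrier by auto
  have "s \<odot>\<^bsub>N\<^esub> (r \<odot>\<^bsub>N\<^esub> x) = r \<odot>\<^bsub>N\<^esub> (s \<odot>\<^bsub>N\<^esub> x)"
    using carr assms(1) by (metis N.smult_assoc1 m_comm)
  then show "s \<odot>\<^bsub>N\<^esub> (r \<odot>\<^bsub>N\<^esub> x) = \<zero>\<^bsub>N\<^esub>" using annD[OF assms(2) s] assms(1) by simp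
qed

lemma ann_subgroup: "additive_subgroup (ann G N n) N"
proof (intro additive_subgroup.intro N.add.subgroupI)
  show "ann G N n \<subseteq> carrier N" using ann_carrier by blast
  have "\<zero>\<^bsub>N\<^esub> \<in> ann G N n" by (rule annI) (use component_carrier in auto)
  then show "ann G N n \<noteq> {}" by blast
  fix x y assume x: "x \<in> ann G N n" and y: "y \<in> ann G N n"
  show "\<ominus>\<^bsub>N\<^esub> x \<in> ann G N n"
    by (rule annI) (use x ann_carrier annD component_carrier in \<open>auto simp: N.smult_r_minus\<close>)
  show "x \<oplus>\<^bsub>N\<^esub> y \<in> ann G N n"
    by (rule annI) (use x y ann_carrier annD component_carrier in \<open>auto simp: N.smult_r_distr\<close>)
qed

text \<open>Membership in \<open>ann\<close> is tested by homogeneous scalars, and these commute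
  with taking components up to a shift of degree.\<close>

lemma ann_gcomp:
  assumes "x \<in> ann G N n"
  shows "gcomp N (hcomp N) x j \<in> ann G N n"
proof (rule annI)
  have x: "x \<in> carrier N" using assms ann_carrier by simp
  show "gcomp N (hcomp N) x j \<in> carrier N" using N.gcomp_closed[OF x] .
  fix a r assume "n \<le> a" "r \<in> G a"
  then show "r \<odot>\<^bsub>N\<^esub> gcomp N (hcomp N) x j = \<zero>\<^bsub>N\<^esub>"
    using gcomp_smult[of r a x j] x annD[OF assms, of a r]
      N.gcomp_homogeneous[OF N.component_zero, of "int a + j" "int a + j"] by simp
qed

lemma G_smult_ann:
  assumes "r \<in> G b" "x \<in> ann G N (n + b)"
  shows "r \<odot>\<^bsub>N\<^esub> x \<in> ann G N n"
proof (rule annI)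
  have carr: "r \<in> carrier R" "x \<in> carrier N" using assms component_carrier ann_carrier by auto
  then show "r \<odot>\<^bsub>N\<^esub> x \<in> carrier N" by simp
  fix a s assume s: "n \<le> a" "s \<in> G a"
  then have "s \<odot>\<^bsub>N\<^esub> (r \<odot>\<^bsub>N\<^esub> x) = (s \<otimes> r) \<odot>\<^bsub>N\<^esub> x"
    using carr component_carrier by (simp add: N.smult_assoc1)
  then show "s \<odot>\<^bsub>N\<^esub> (r \<odot>\<^bsub>N\<^esub> x) = \<zero>\<^bsub>N\<^esub>"
    using annD[OF assms(2), of "a + b"] G_mult[OF s(2) assms(1)] s by simp
qed

text \<open>The scalars that carry \<open>x\<close> into level \<open>n\<close> form an ideal. It
  contains every \<open>G a\<close> with \<open>a\<close> positive, hence the ideal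
  \<open>mm\<close> that these generate.\<close>

lemma mm_smult_ann:
  assumes "r \<in> mm" "x \<in> ann G N (Suc n)"
  shows "r \<odot>\<^bsub>N\<^esub> x \<in> ann G N n"
proof -
  interpret A: additive_subgroup "ann G N n" N by (rule ann_subgroup)
  have x: "x \<in> carrier N" using assms ann_carrier by simp
  let ?J = "{r \<in> carrier R. r \<odot>\<^bsub>N\<^esub> x \<in> ann G N n}"
  have "ideal ?J R"
  proof (rule idealI)
    show "ring R" by (rule ring_axioms)
    show "subgroup ?J (add_monoid R)"
    proof (rule add.subgroupI)
      have "\<zero> \<in> ?J" using A.zero_closed x by simp
      then show "?J \<noteq> {}" by blast
    qed (use x in \<open>auto simp: N.smult_l_minus N.smult_l_distr A.a_inv_closed\<close>)
    fix s r assume "s \<in> ?J" "r \<in> carrier R"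
    then show "r \<otimes> s \<in> ?J" "s \<otimes> r \<in> ?J"
      using ann_smult x by (auto simp: N.smult_assoc1 m_comm[of s r])
  qed
  moreover have "(\<Union>a\<in>{1..}. G a) \<subseteq> ?J"
  proof
    fix r assume "r \<in> (\<Union>a\<in>{1..}. G a)"
    then obtain a where a: "1 \<le> a" "r \<in> G a" by auto
    then have "r \<odot>\<^bsub>N\<^esub> x \<in> ann G N n" using G_smult_ann[OF a(2)] ann_mono[OF assms(2)] by simp
    then show "r \<in> ?J" using a component_carrier by auto
  qed
  ultimately have "mm \<subseteq> ?J" unfolding irrelevant_ideal_def by (rule genideal_minimal)
  then show ?thesis using assms by auto
qed

text \<open>In a product from \<open>mpow (Suc n)\<close> the factor in \<open>mm\<close> lowers the
  level of \<open>x\<close> by one, and induction treats the other factor. At level 0 the scalar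
  \<open>\<one>\<close> already kills \<open>x\<close>.\<close>

lemma mpow_smult_ann: "x \<in> ann G N n \<Longrightarrow> r \<in> mpow n \<Longrightarrow> r \<odot>\<^bsub>N\<^esub> x = \<zero>\<^bsub>N\<^esub>"
proof (induction n arbitrary: r x)
  case 0
  have "\<one> \<odot>\<^bsub>N\<^esub> x = \<zero>\<^bsub>N\<^esub>" using annD[OF 0(1) _ one_G_0] by simp
  then show ?case using 0 ann_carrier mpow_0 by auto
next
  case (Suc n)
  from Suc.prems(2) have "r \<in> ideal_prod R (mpow n) mm" by (simp only: mpow_Suc)
  then show ?case
  proof (induction rule: ideal_prod.induct)
    case (prod s t)
    have "s \<in> carrier R" "t \<in> carrier R" "x \<in> carrier N"
      using prod ideal.Icarr[OF mpow_ideal] ideal.Icarr[OF mm_ideal] Suc.prems ann_carrier by auto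
    then show ?case
      using Suc.IH[OF mm_smult_ann[OF prod(2) Suc.prems(1)] prod(1)] by (simp add: N.smult_assoc1)
  next
    case (sum s t)
    have "s \<in> carrier R" "t \<in> carrier R"
      using sum ideal_prod_in_carrier[OF mpow_ideal mm_ideal] by auto
    then show ?case using sum Suc.prems ann_carrier by (simp add: N.smult_l_distr)
  qed
qed

lemma ann_iff_mpow: "x \<in> ann G N n \<longleftrightarrow> x \<in> carrier N \<and> (\<forall>r\<in>mpow n. r \<odot>\<^bsub>N\<^esub> x = \<zero>\<^bsub>N\<^esub>)"
  using mpow_smult_ann ann_carrier G_mpow by (auto intro: annI)

text \<open>Phrased with \<open>mm\<close> itself instead of \<open>mpow 1\<close>, to match the
  quotient that defines \<open>residue_field\<close>.\<close>

lemma ann_1_iff: "x \<in> ann G N 1 \<longleftrightarrow> x \<in> carrier N \<and> (\<forall>r\<in>mm. r \<odot>\<^bsub>N\<^esub> x = \<zero>\<^bsub>N\<^esub>)"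
proof -
  have "r \<odot>\<^bsub>N\<^esub> x = \<zero>\<^bsub>N\<^esub>" if "x \<in> ann G N 1" "r \<in> mm" for r
  proof -
    have "r \<odot>\<^bsub>N\<^esub> x \<in> ann G N 0" using mm_smult_ann that by simp
    then show ?thesis using annD[of _ 0 0 \<one>] one_G_0 ann_carrier by fastforce
  qed
  then show ?thesis using ann_carrier G_mm by (auto intro: annI)
qed

lemma torsion_carrier: "carrier (torsion_submodule R G N) = (\<Union>n. ann G N n)"
  using ann_iff_mpow by (auto simp: torsion_submodule_def sub_gmodule_def)

lemma torsion_simps [simp]:
  "zero (torsion_submodule R G N) = \<zero>\<^bsub>N\<^esub>"
  "add (torsion_submodule R G N) = add N"
  "hcomp (torsion_submodule R G N) j = hcomp N j \<inter> (\<Union>n. ann G N n)"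
  using torsion_carrier by (auto simp: torsion_submodule_def sub_gmodule_def)

end

section \<open>Extension of linear maps\<close>

text \<open>\<open>P\<close> is a linear relation that is total on a basis, so it contains the graph
  of a linear map on the span. In \<open>descent\<close> it relates a scalar to the possible
  primitives of its product with \<open>u\<close>, of which one must be chosen linearly.\<close>

lemma linear_selection:
  fixes R (structure)
  assumes "module R N" "subfield K R" "ring.independent R K Us"
    and carr: "\<And>v s. P v s \<Longrightarrow> s \<in> carrier N"
    and zero: "P \<zero> \<zero>\<^bsub>N\<^esub>"
    and add: "\<And>v s w t. P v s \<Longrightarrow> P w t \<Longrightarrow> P (v \<oplus> w) (s \<oplus>\<^bsub>N\<^esub> t)"
    and smult: "\<And>c v s. c \<in> K \<Longrightarrow> P v s \<Longrightarrow> P (c \<otimes> v) (c \<odot>\<^bsub>N\<^esub> s)"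
    and base: "\<And>u. u \<in> set Us \<Longrightarrow> \<exists>s. P u s"
  shows "\<exists>\<sigma>. (\<forall>v\<in>ring.Span R K Us. P v (\<sigma> v)) \<and>
    (\<forall>v\<in>ring.Span R K Us. \<forall>w\<in>ring.Span R K Us. \<sigma> (v \<oplus> w) = \<sigma> v \<oplus>\<^bsub>N\<^esub> \<sigma> w) \<and>
    (\<forall>c\<in>K. \<forall>v\<in>ring.Span R K Us. \<sigma> (c \<otimes> v) = c \<odot>\<^bsub>N\<^esub> \<sigma> v)"
proof -
  interpret N: module R N by fact
  have K: "c \<in> carrier R" if "c \<in> K" for c
    using that subringE(1)[OF subfieldE(1)[OF assms(2)]] by blast
  note Kring = subringE(5-7)[OF subfieldE(1)[OF assms(2)]]
  show ?thesis
    using assms(3) base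
  proof (induction Us rule: list.induct)
    case Nil
    show ?case by (rule exI[of _ "\<lambda>_. \<zero>\<^bsub>N\<^esub>"]) (use zero K in auto)
  next
    case (Cons u Us)
    let ?V = "N.R.Span K Us"
    have u: "u \<in> carrier R" "u \<notin> ?V" and ind: "N.R.independent K Us"
      using N.R.independent_backwards[OF Cons.prems(1)] by auto
    have Us: "set Us \<subseteq> carrier R" using N.R.independent_in_carrier[OF ind] .
    note V = N.R.Span_subgroup_props[OF assms(2) Us] N.R.Span_smult_closed[OF assms(2) Us]
    have Vc: "v \<in> carrier R" if "v \<in> ?V" for v using V(1) that by blast
    have base': "\<exists>s. P v s" if "v \<in> set Us" for v using Cons.prems(2) that by simp
    obtain \<sigma> where \<sigma>: "\<And>v. v \<in> ?V \<Longrightarrow> P v (\<sigma> v)"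
      "\<And>v w. v \<in> ?V \<Longrightarrow> w \<in> ?V \<Longrightarrow> \<sigma> (v \<oplus> w) = \<sigma> v \<oplus>\<^bsub>N\<^esub> \<sigma> w"
      "\<And>c v. c \<in> K \<Longrightarrow> v \<in> ?V \<Longrightarrow> \<sigma> (c \<otimes> v) = c \<odot>\<^bsub>N\<^esub> \<sigma> v"
      using Cons.IH[OF ind base'] by blast
    obtain s where s: "P u s" using Cons.prems(2) by auto
    \<comment> \<open>Subtracting two representations puts a multiple of \<open>u\<close> by an
      element of \<open>K\<close> into the span of the tail; independence forces that element to be
      zero.\<close>
    have unique: "c = c' \<and> v = v'"
      if eq: "c \<otimes> u \<oplus> v = c' \<otimes> u \<oplus> v'" and mem: "c \<in> K" "c' \<in> K" "v \<in> ?V" "v' \<in> ?V"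
      for c c' v v'
    proof -
      have cr: "c \<in> carrier R" "c' \<in> carrier R" "v \<in> carrier R" "v' \<in> carrier R"
        using mem K Vc by auto
      have "(c \<ominus> c') \<otimes> u = (c \<otimes> u \<oplus> v) \<ominus> v \<ominus> c' \<otimes> u" using cr u by algebra
      also have "\<dots> = v' \<oplus> \<ominus> v" unfolding eq using cr u by algebra
      finally have "(c \<ominus> c') \<otimes> u \<in> ?V" using V(3,4) mem by simp
      moreover have "c \<ominus> c' \<in> K" using Kring mem by (simp add: N.R.minus_eq)
      ultimately have "c \<ominus> c' = \<zero>"
        using N.R.Span_m_inv_simprule[OF assms(2) Us, of "c \<ominus> c'" u] u by blast
      then have "c = c'" using cr by simp
      then show ?thesis using eq cr u by simp
    qed
    \<comment> \<open>By \<open>unique\<close> the description has exactly one solution on the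
      larger span; it extends \<open>\<sigma>\<close> by sending \<open>u\<close> to
      \<open>s\<close>.\<close>
    define \<tau> where "\<tau> x = (THE y. \<exists>c\<in>K. \<exists>v\<in>?V. x = c \<otimes> u \<oplus> v \<and> y = c \<odot>\<^bsub>N\<^esub> s \<oplus>\<^bsub>N\<^esub> \<sigma> v)" for x
    have \<tau>: "\<tau> (c \<otimes> u \<oplus> v) = c \<odot>\<^bsub>N\<^esub> s \<oplus>\<^bsub>N\<^esub> \<sigma> v" if "c \<in> K" "v \<in> ?V" for c v
      unfolding \<tau>_def
    proof (rule the_equality)
      fix y assume "\<exists>c'\<in>K. \<exists>v'\<in>?V. c \<otimes> u \<oplus> v = c' \<otimes> u \<oplus> v' \<and> y = c' \<odot>\<^bsub>N\<^esub> s \<oplus>\<^bsub>N\<^esub> \<sigma> v'"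
      then obtain c' v' where "c' \<in> K" "v' \<in> ?V" "c \<otimes> u \<oplus> v = c' \<otimes> u \<oplus> v'"
        "y = c' \<odot>\<^bsub>N\<^esub> s \<oplus>\<^bsub>N\<^esub> \<sigma> v'" by blast
      then show "y = c \<odot>\<^bsub>N\<^esub> s \<oplus>\<^bsub>N\<^esub> \<sigma> v" using unique[of c v c' v'] that by simp
    qed (use that in blast)
    have span: "\<exists>c\<in>K. \<exists>v\<in>?V. x = c \<otimes> u \<oplus> v" if "x \<in> N.R.Span K (u # Us)" for x
      using that by (simp add: N.R.line_extension_mem_iff)
    show ?case
    proof (intro exI[of _ \<tau>] conjI ballI)
      fix x assume "x \<in> N.R.Span K (u # Us)"
      then obtain c v where x: "c \<in> K" "v \<in> ?V" "x = c \<otimes> u \<oplus> v" using span by blast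
      then show "P x (\<tau> x)" using \<tau> add smult s \<sigma>(1) by simp
      {
        fix d assume d: "d \<in> K"
        have "d \<otimes> x = (d \<otimes> c) \<otimes> u \<oplus> d \<otimes> v"
          unfolding x(3) using x K Vc u d by (simp add: N.R.r_distr N.R.m_assoc)
        then have "\<tau> (d \<otimes> x) = (d \<otimes> c) \<odot>\<^bsub>N\<^esub> s \<oplus>\<^bsub>N\<^esub> d \<odot>\<^bsub>N\<^esub> \<sigma> v"
          using \<tau>[of "d \<otimes> c" "d \<otimes> v"] x d Kring V(5) \<sigma>(3) by simp
        then show "\<tau> (d \<otimes> x) = d \<odot>\<^bsub>N\<^esub> \<tau> x"
          using x \<tau> d K carr[OF s] carr[OF \<sigma>(1)] by (simp add: N.smult_r_distr N.smult_assoc1)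
      }
      fix y assume "y \<in> N.R.Span K (u # Us)"
      then obtain c' v' where y: "c' \<in> K" "v' \<in> ?V" "y = c' \<otimes> u \<oplus> v'" using span by blast
      have "x \<oplus> y = (c \<oplus> c') \<otimes> u \<oplus> (v \<oplus> v')"
        using K[OF x(1)] K[OF y(1)] Vc[OF x(2)] Vc[OF y(2)] u(1)
        unfolding x(3) y(3) by (simp add: N.R.l_distr N.R.a_ac)
      then have "\<tau> (x \<oplus> y) = (c \<oplus> c') \<odot>\<^bsub>N\<^esub> s \<oplus>\<^bsub>N\<^esub> (\<sigma> v \<oplus>\<^bsub>N\<^esub> \<sigma> v')"
        using \<tau>[of "c \<oplus> c'" "v \<oplus> v'"] x y Kring V(3) \<sigma>(2) by simp
      then show "\<tau> (x \<oplus> y) = \<tau> x \<oplus>\<^bsub>N\<^esub> \<tau> y"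
        using x y \<tau> K carr[OF s] carr[OF \<sigma>(1)] by (simp add: N.smult_l_distr N.M.a_ac)
    qed
  qed
qed

text \<open>Explicit additive projections \<open>\<pi>\<close> settle uniqueness: applied to an
  arbitrary decomposition of \<open>x\<close>, they return its terms.\<close>

lemma is_gradingI:
  fixes A (structure) and \<pi> :: "'b \<Rightarrow> 'i \<Rightarrow> 'b"
  assumes "abelian_group A" and sub: "\<And>i. additive_subgroup (N i) A"
    and add: "\<And>x y i. x \<in> carrier A \<Longrightarrow> y \<in> carrier A \<Longrightarrow> \<pi> (x \<oplus> y) i = \<pi> x i \<oplus> \<pi> y i"
    and hom: "\<And>x i l. x \<in> N i \<Longrightarrow> \<pi> x l = (if l = i then x else \<zero>)"
    and mem: "\<And>x i. x \<in> carrier A \<Longrightarrow> \<pi> x i \<in> N i"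
    and fin: "\<And>x. x \<in> carrier A \<Longrightarrow> finite {i. \<pi> x i \<noteq> \<zero>}"
    and sum: "\<And>x. x \<in> carrier A \<Longrightarrow> x = (\<Oplus>i\<in>{i. \<pi> x i \<noteq> \<zero>}. \<pi> x i)"
  shows "is_grading A N"
  unfolding is_grading_def
proof (intro conjI allI ballI)
  interpret A: abelian_group A by fact
  show "additive_subgroup (N i) A" for i by (rule sub)
  fix x assume x: "x \<in> carrier A"
  show "\<exists>!c. (\<forall>i. c i \<in> N i) \<and> finite {i. c i \<noteq> \<zero>} \<and> x = (\<Oplus>i\<in>{i. c i \<noteq> \<zero>}. c i)"
  proof (rule ex1I[of _ "\<pi> x"])
    show "(\<forall>i. \<pi> x i \<in> N i) \<and> finite {i. \<pi> x i \<noteq> \<zero>} \<and> x = (\<Oplus>i\<in>{i. \<pi> x i \<noteq> \<zero>}. \<pi> x i)"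
      using mem[OF x] fin[OF x] sum[OF x] by blast
    fix c assume c: "(\<forall>i. c i \<in> N i) \<and> finite {i. c i \<noteq> \<zero>} \<and> x = (\<Oplus>i\<in>{i. c i \<noteq> \<zero>}. c i)"
    have cc: "c i \<in> carrier A" for i using c additive_subgroup.a_Hcarr[OF sub] by blast
    have "\<pi> (\<Oplus>i\<in>F. c i) l = (if l \<in> F then c l else \<zero>)" if "finite F" for F l
      using that
    proof (induction F)
      case empty
      then show ?case using hom[of \<zero> l l] additive_subgroup.zero_closed[OF sub] by simp
    next
      case (insert i F)
      then show ?case using cc c hom[of "c i" i l] add[of "c i" "\<Oplus>i\<in>F. c i" l]
        by (auto simp: Pi_def A.finsum_closed)
    qed
    from this[of "{i. c i \<noteq> \<zero>}"] have "\<pi> x l = c l" for l using c by (metis mem_Collect_eq)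
    then show "c = \<pi> x" by (simp add: fun_eq_iff)
  qed
qed

text \<open>A homogeneous ideal \<open>H\<close> of \<open>R\<close>, shifted so that \<open>1\<close> would have degree \<open>j\<close>, carried by
  the type over which the test modules of \<open>injective_gmodule\<close> range.\<close>

definition emb :: "'r \<Rightarrow> nat \<Rightarrow> 'r + 'e" where "emb r = (\<lambda>_. Inl r)"

definition unemb :: "(nat \<Rightarrow> 'r + 'e) \<Rightarrow> 'r" where "unemb u = projl (u 0)"

definition shifted_ideal ::
  "'r ring \<Rightarrow> (nat \<Rightarrow> 'r set) \<Rightarrow> 'r set \<Rightarrow> int \<Rightarrow> ('r, nat \<Rightarrow> 'r + 'e) gmodule" where
  "shifted_ideal R G H j =
     \<lparr>carrier = emb ` H, mult = (\<lambda>_ _. emb \<zero>\<^bsub>R\<^esub>), one = emb \<zero>\<^bsub>R\<^esub>, zero = emb \<zero>\<^bsub>R\<^esub>,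
      add = (\<lambda>u v. emb (unemb u \<oplus>\<^bsub>R\<^esub> unemb v)), smult = (\<lambda>r u. emb (r \<otimes>\<^bsub>R\<^esub> unemb u)),
      hcomp = (\<lambda>l. emb ` (if j \<le> l then G (nat (l - j)) \<inter> H else {\<zero>\<^bsub>R\<^esub>}))\<rparr>"

lemma unemb_emb [simp]: "unemb (emb r) = r"
  by (simp add: emb_def unemb_def)

lemma emb_eq_iff [simp]: "emb r = emb s \<longleftrightarrow> r = s"
  by (metis unemb_emb)

context std_graded
begin

lemma shifted_ideal_graded:
  assumes "ideal H R" and comp: "\<And>t a. t \<in> H \<Longrightarrow> gcomp R G t a \<in> H"
  shows "graded_module R G (shifted_ideal R G H j :: ('r, nat \<Rightarrow> 'r + 'e) gmodule)" (is "graded_module R G ?A")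
proof -
  interpret H: ideal H R by fact
  have mod: "module R ?A"
  proof (rule moduleI)
    show "abelian_group ?A"
    proof (rule abelian_groupI)
      fix x assume "x \<in> carrier ?A"
      then obtain t where "t \<in> H" "x = emb t" by (auto simp: shifted_ideal_def)
      then show "\<exists>y\<in>carrier ?A. y \<oplus>\<^bsub>?A\<^esub> x = \<zero>\<^bsub>?A\<^esub>"
        by (intro bexI[of _ "emb (\<ominus> t)"]) (auto simp: shifted_ideal_def l_neg)
    qed (auto simp: shifted_ideal_def a_ac)
  qed (auto simp: shifted_ideal_def is_cring l_distr r_distr m_assoc H.I_l_closed)
  interpret A: module R ?A by fact
  \<comment> \<open>Degree \<open>l\<close> of the shifted module is degree \<open>l - j\<close> of
    \<open>R\<close>, and every degree below \<open>j\<close> is zero. The assumption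
    \<open>comp\<close> keeps these projections inside \<open>H\<close>.\<close>
  define \<pi> where "\<pi> u l = (if j \<le> l then emb (gcomp R G (unemb u) (nat (l - j))) else \<zero>\<^bsub>?A\<^esub>)"
    for u :: "nat \<Rightarrow> 'r + 'e" and l
  have "is_grading ?A (hcomp ?A)"
  proof (rule is_gradingI[where \<pi> = \<pi>])
    show "abelian_group ?A" by (rule A.M.abelian_group_axioms)
    show "additive_subgroup (hcomp ?A l) ?A" for l
    proof (intro additive_subgroup.intro A.M.add.subgroupI)
      have "emb \<zero> \<in> hcomp ?A l" using component_zero by (simp add: shifted_ideal_def)
      then show "hcomp ?A l \<noteq> {}" by blast
      fix x assume "x \<in> hcomp ?A l"
      then obtain t where t: "t \<in> (if j \<le> l then G (nat (l - j)) \<inter> H else {\<zero>})" "x = emb t"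
        by (auto simp: shifted_ideal_def)
      then have tH: "t \<in> H" by (auto split: if_splits)
      have "\<ominus>\<^bsub>?A\<^esub> x = emb (\<ominus> t)"
        by (rule A.M.minus_equality) (use t tH in \<open>auto simp: shifted_ideal_def l_neg\<close>)
      then show "\<ominus>\<^bsub>?A\<^esub> x \<in> hcomp ?A l"
        using t component_minus by (auto simp: shifted_ideal_def split: if_splits)
    qed (auto simp: shifted_ideal_def component_zero component_add image_iff)
    fix x l assume "x \<in> carrier ?A"
    then obtain t where t: "t \<in> H" "x = emb t" by (auto simp: shifted_ideal_def)
    then have tc: "t \<in> carrier R" by simp
    show "\<pi> x l \<in> hcomp ?A l"
      using t tc gcomp_in comp by (auto simp: \<pi>_def shifted_ideal_def)
    let ?F = "{a. gcomp R G t a \<noteq> \<zero>}"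
    have supp: "{l. \<pi> x l \<noteq> \<zero>\<^bsub>?A\<^esub>} = (\<lambda>a. int a + j) ` ?F"
    proof (intro subset_antisym subsetI)
      fix l assume "l \<in> {l. \<pi> x l \<noteq> \<zero>\<^bsub>?A\<^esub>}"
      then have "j \<le> l" "nat (l - j) \<in> ?F"
        using t by (auto simp: \<pi>_def shifted_ideal_def split: if_splits)
      then show "l \<in> (\<lambda>a. int a + j) ` ?F" by (intro image_eqI[of _ _ "nat (l - j)"]) auto
    qed (use t in \<open>auto simp: \<pi>_def shifted_ideal_def\<close>)
    then show "finite {l. \<pi> x l \<noteq> \<zero>\<^bsub>?A\<^esub>}" using gcomp_finite[OF tc] by simp
    \<comment> \<open>Addition in \<open>?A\<close> is that of \<open>R\<close> seen through
      \<open>emb\<close>, and the shift of degrees is injective, so finite sums transfer term by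
      term.\<close>
    have "emb (\<Oplus>a\<in>F. gcomp R G t a) = (\<Oplus>\<^bsub>?A\<^esub>l\<in>(\<lambda>a. int a + j) ` F. \<pi> x l)" if "finite F" for F
      using that
    proof (induction F)
      case empty
      have "\<zero>\<^bsub>?A\<^esub> = emb \<zero>" by (simp add: shifted_ideal_def)
      then show ?case by simp
    next
      case (insert a F)
      have \<pi>c: "\<pi> x l \<in> carrier ?A" for l
        using t comp by (auto simp: \<pi>_def shifted_ideal_def)
      have "(\<Oplus>\<^bsub>?A\<^esub>l\<in>(\<lambda>a. int a + j) ` insert a F. \<pi> x l) =
          \<pi> x (int a + j) \<oplus>\<^bsub>?A\<^esub> (\<Oplus>\<^bsub>?A\<^esub>l\<in>(\<lambda>a. int a + j) ` F. \<pi> x l)"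
        using insert \<pi>c by (simp add: image_iff Pi_def)
      also have "\<dots> = emb (gcomp R G t a \<oplus> (\<Oplus>a\<in>F. gcomp R G t a))"
        unfolding insert.IH[symmetric] using t by (simp add: \<pi>_def shifted_ideal_def)
      finally show ?case using insert gcomp_closed[OF tc] by (simp add: Pi_def)
    qed
    then show "x = (\<Oplus>\<^bsub>?A\<^esub>l\<in>{l. \<pi> x l \<noteq> \<zero>\<^bsub>?A\<^esub>}. \<pi> x l)"
      unfolding supp using gcomp_spec[OF tc] gcomp_finite[OF tc] t by metis
    fix y assume "y \<in> carrier ?A"
    then obtain s where "s \<in> H" "y = emb s" by (auto simp: shifted_ideal_def)
    then show "\<pi> (x \<oplus>\<^bsub>?A\<^esub> y) l = \<pi> x l \<oplus>\<^bsub>?A\<^esub> \<pi> y l"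
      using t gcomp_add by (auto simp: \<pi>_def shifted_ideal_def)
  next
    fix x i l assume "x \<in> hcomp ?A i"
    then obtain t where t: "t \<in> (if j \<le> i then G (nat (i - j)) \<inter> H else {\<zero>})" "x = emb t"
      by (auto simp: shifted_ideal_def)
    show "\<pi> x l = (if l = i then x else \<zero>\<^bsub>?A\<^esub>)"
    proof (cases "j \<le> i")
      case True
      then have "t \<in> G (nat (i - j))" using t by simp
      then show ?thesis
        using gcomp_homogeneous[of t "nat (i - j)" "nat (l - j)"] t(2) True
        by (auto simp: \<pi>_def shifted_ideal_def)
    next
      case False
      then show ?thesis
        using gcomp_homogeneous[OF component_zero, of "nat (l - j)" "nat (l - j)"] t
        by (auto simp: \<pi>_def shifted_ideal_def)
    qed
  qed
  moreover have "r \<odot>\<^bsub>?A\<^esub> x \<in> hcomp ?A (int a + l)" if r: "r \<in> G a" and x: "x \<in> hcomp ?A l" for r x a l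
  proof -
    obtain t where t: "t \<in> (if j \<le> l then G (nat (l - j)) \<inter> H else {\<zero>})" "x = emb t"
      using x by (auto simp: shifted_ideal_def)
    have rc: "r \<in> carrier R" using r component_carrier by simp
    have smult: "r \<odot>\<^bsub>?A\<^esub> x = emb (r \<otimes> t)" using t by (simp add: shifted_ideal_def)
    show ?thesis
    proof (cases "j \<le> l")
      case True
      have "r \<otimes> t \<in> G (a + nat (l - j))" "r \<otimes> t \<in> H"
        using G_mult[OF r] t True H.I_l_closed rc by auto
      moreover have "a + nat (l - j) = nat (int a + l - j)" using True by simp
      ultimately show ?thesis using True unfolding smult by (simp add: shifted_ideal_def)
    next
      case False
      then show ?thesis using t rc component_zero unfolding smult by (auto simp: shifted_ideal_def)
    qed
  qed
  ultimately show ?thesis using mod by (simp add: graded_module_def)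
qed

section \<open>Extending maps from homogeneous ideals into injective modules\<close>

lemma std_graded_moduleI: "graded_module R G N \<Longrightarrow> std_graded_module R k G N"
  by (intro std_graded_module.intro std_graded_axioms std_graded_module_axioms.intro)
    (simp_all add: graded_module_def)

text \<open>Injectivity extends the map from the shifted ideal to the shifted ring, and a linear map
  out of the ring is multiplication on the image \<open>g\<close> of \<open>\<one>\<close>. The
  shift turns a map of degree \<open>j\<close> into one of degree 0, the only kind that
  \<open>injective_gmodule\<close> treats.\<close>

lemma ideal_hom_extend:
  fixes E :: "('r, 'e) gmodule"
  assumes inj: "injective_gmodule R G E"
    and "ideal H R" and comp: "\<And>t a. t \<in> H \<Longrightarrow> gcomp R G t a \<in> H"
    and closed: "\<And>t. t \<in> H \<Longrightarrow> \<phi> t \<in> carrier E"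
    and add: "\<And>t s. t \<in> H \<Longrightarrow> s \<in> H \<Longrightarrow> \<phi> (t \<oplus> s) = \<phi> t \<oplus>\<^bsub>E\<^esub> \<phi> s"
    and linear: "\<And>r t. r \<in> carrier R \<Longrightarrow> t \<in> H \<Longrightarrow> \<phi> (r \<otimes> t) = r \<odot>\<^bsub>E\<^esub> \<phi> t"
    and deg: "\<And>t a. t \<in> H \<Longrightarrow> t \<in> G a \<Longrightarrow> \<phi> t \<in> hcomp E (int a + j)"
  shows "\<exists>g\<in>hcomp E j. \<forall>t\<in>H. t \<odot>\<^bsub>E\<^esub> g = \<phi> t"
proof -
  interpret H: ideal H R by fact
  have gmE: "graded_module R G E" using inj by (simp add: injective_gmodule_def)
  then interpret E: std_graded_module R k G E by (rule std_graded_moduleI)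
  let ?A = "shifted_ideal R G H j :: ('r, nat \<Rightarrow> 'r + 'e) gmodule"
  let ?B = "shifted_ideal R G (carrier R) j :: ('r, nat \<Rightarrow> 'r + 'e) gmodule"
  have A: "graded_module R G ?A" by (rule shifted_ideal_graded[OF \<open>ideal H R\<close> comp])
  have B: "graded_module R G ?B" by (rule shifted_ideal_graded[OF oneideal gcomp_closed])
  \<comment> \<open>Both modules are carried by the same copy of \<open>R\<close>, so the inclusion
    is \<open>id\<close>.\<close>
  have id: "id \<in> gmod_hom R ?A ?B 0"
    by (auto simp: gmod_hom_def mod_hom_def shifted_ideal_def)
  have "\<phi> \<zero> = \<zero>\<^bsub>E\<^esub>" using linear[of \<zero> \<zero>] closed by simp
  have deg': "\<phi> t \<in> hcomp E l" if "j \<le> l" "t \<in> G (nat (l - j))" "t \<in> H" for t l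
    using deg[OF that(3,2)] that(1) by simp
  with \<open>\<phi> \<zero> = \<zero>\<^bsub>E\<^esub>\<close> have \<phi>: "\<phi> \<circ> unemb \<in> gmod_hom R ?A E 0"
    using closed add linear E.N.component_zero unfolding gmod_hom_def mod_hom_def
    by (auto simp: shifted_ideal_def split: if_splits)
  obtain h where h: "h \<in> gmod_hom R ?B E 0" "\<forall>x\<in>carrier ?A. h (id x) = (\<phi> \<circ> unemb) x"
    using inj[unfolded injective_gmodule_def, THEN conjunct2, rule_format, of ?A ?B id "\<phi> \<circ> unemb"]
      A B id \<phi> by auto
  have "emb \<one> \<in> hcomp ?B j" using one_G_0 by (simp add: shifted_ideal_def)
  then have "h (emb \<one>) \<in> hcomp E j" using h(1) by (auto simp: gmod_hom_def)
  moreover have "t \<odot>\<^bsub>E\<^esub> h (emb \<one>) = \<phi> t" if t: "t \<in> H" for t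
  proof -
    have "emb \<one> \<in> carrier ?B" by (simp add: shifted_ideal_def)
    then have "h (t \<odot>\<^bsub>?B\<^esub> emb \<one>) = t \<odot>\<^bsub>E\<^esub> h (emb \<one>)"
      using h(1) H.Icarr[OF t] unfolding gmod_hom_def mod_hom_def by blast
    then have "t \<odot>\<^bsub>E\<^esub> h (emb \<one>) = h (emb t)" using t by (simp add: shifted_ideal_def)
    then show ?thesis using h(2) t by (simp add: shifted_ideal_def)
  qed
  ultimately show ?thesis by blast
qed

text \<open>Extended by zero to degrees above \<open>n\<close>, the \<open>k\<close>-linear map
  \<open>\<sigma>\<close> is \<open>R\<close>-linear on the ideal of elements living in degrees at
  least \<open>n\<close>, because its values lie in the socle. The ideal extension property then
  represents it by some \<open>g\<close>, and the extension by zero says that \<open>g\<close> is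
  killed by every degree above \<open>n\<close>.\<close>

lemma socle_map_extend:
  fixes E :: "('r, 'e) gmodule"
  assumes inj: "injective_gmodule R G E"
    and soc: "\<And>v. v \<in> G n \<Longrightarrow> \<sigma> v \<in> ann G E 1 \<inter> hcomp E (int n + j)"
    and add: "\<And>v w. v \<in> G n \<Longrightarrow> w \<in> G n \<Longrightarrow> \<sigma> (v \<oplus> w) = \<sigma> v \<oplus>\<^bsub>E\<^esub> \<sigma> w"
    and linear: "\<And>c v. c \<in> k \<Longrightarrow> v \<in> G n \<Longrightarrow> \<sigma> (c \<otimes> v) = c \<odot>\<^bsub>E\<^esub> \<sigma> v"
  shows "\<exists>g\<in>hcomp E j \<inter> ann G E (Suc n). \<forall>v\<in>G n. v \<odot>\<^bsub>E\<^esub> g = \<sigma> v"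
proof -
  have gmE: "graded_module R G E" using inj by (simp add: injective_gmodule_def)
  then interpret E: std_graded_module R k G E by (rule std_graded_moduleI)
  \<comment> \<open>\<open>H\<close> is the ideal just described; \<open>\<phi>\<close> applies
    \<open>\<sigma>\<close> to the component of degree \<open>n\<close> and ignores all higher
    ones.\<close>
  define H where "H = {t \<in> carrier R. \<forall>a<n. gcomp R G t a = \<zero>}"
  define \<phi> where "\<phi> t = \<sigma> (gcomp R G t n)" for t
  have Hc: "t \<in> carrier R" if "t \<in> H" for t using that by (simp add: H_def)
  have gcomp_0: "gcomp R G \<zero> a = \<zero>" for a using gcomp_homogeneous[OF component_zero, of a a] by simp
  have \<sigma>c: "\<sigma> v \<in> carrier E" if "v \<in> G n" for v using soc[OF that] E.ann_carrier by blast
  have "\<sigma> (\<zero> \<otimes> \<zero>) = \<zero> \<odot>\<^bsub>E\<^esub> \<sigma> \<zero>"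
    using linear[of \<zero> \<zero>] component_zero[of 0] G_0 component_zero[of n] by simp
  then have \<sigma>0: "\<sigma> \<zero> = \<zero>\<^bsub>E\<^esub>" using \<sigma>c component_zero by simp
  have add_mem: "t \<oplus> s \<in> H" if "t \<in> H" "s \<in> H" for t s using that gcomp_add by (simp add: H_def)
  have mult_mem: "r \<otimes> t \<in> H \<and> \<phi> (r \<otimes> t) = r \<odot>\<^bsub>E\<^esub> \<phi> t" if "r \<in> carrier R" and t: "t \<in> H" for r t
    using that(1)
  proof (induction r rule: graded_induct)
    case zero
    then show ?case using Hc[OF t] gcomp_0 \<sigma>0 \<sigma>c gcomp_in by (simp add: H_def \<phi>_def)
  next
    case (add r s)
    then have "\<phi> (r \<otimes> t \<oplus> s \<otimes> t) = \<phi> (r \<otimes> t) \<oplus>\<^bsub>E\<^esub> \<phi> (s \<otimes> t)"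
      using Hc t gcomp_add gcomp_in assms(3) by (simp add: \<phi>_def)
    then show ?case using add Hc[OF t] \<sigma>c gcomp_in add_mem by (simp add: l_distr \<phi>_def E.N.smult_l_distr)
  next
    case (homogeneous a r)
    note comp = gcomp_mult_homogeneous[OF homogeneous Hc[OF t]]
    have rc: "r \<in> carrier R" using homogeneous component_carrier by simp
    have vanish: "gcomp R G (r \<otimes> t) b = \<zero>" if "b < a + n" for b
    proof (cases "b < a")
      case False
      then obtain l where "b = a + l" using le_Suc_ex not_less by blast
      then show ?thesis using comp(1)[of l] that t rc by (simp add: H_def)
    qed (use comp(2) in simp)
    have "r \<otimes> t \<in> H" using vanish rc Hc[OF t] by (simp add: H_def)
    moreover have "\<phi> (r \<otimes> t) = r \<odot>\<^bsub>E\<^esub> \<phi> t"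
    proof (cases "a = 0")
      case True
      then show ?thesis using comp(1)[of n] linear[of r] gcomp_in[OF Hc[OF t]] homogeneous G_0
        by (simp add: \<phi>_def)
    next
      \<comment> \<open>A scalar of positive degree pushes \<open>t\<close> above degree
        \<open>n\<close> and kills the socle, so both sides are zero.\<close>
      case False
      then have "r \<odot>\<^bsub>E\<^esub> \<phi> t = \<zero>\<^bsub>E\<^esub>"
        using soc[OF gcomp_in[OF Hc[OF t]]] E.annD[of _ 1 a r] homogeneous by (simp add: \<phi>_def)
      then show ?thesis using vanish[of n] False \<sigma>0 by (simp add: \<phi>_def)
    qed
    ultimately show ?case by blast
  qed
  have H_ideal: "ideal H R"
  proof (rule idealI)
    show "ring R" by (rule ring_axioms)
    show "subgroup H (add_monoid R)"
    proof (rule add.subgroupI)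
      have "\<zero> \<in> H" using gcomp_0 by (simp add: H_def)
      then show "H \<noteq> {}" by blast
      show "\<ominus> t \<in> H" if "t \<in> H" for t
        using mult_mem[of "\<ominus> \<one>" t] that Hc[OF that] by (simp add: l_minus)
    qed (use Hc add_mem in auto)
    fix t r assume "t \<in> H" "r \<in> carrier R"
    then show "r \<otimes> t \<in> H" "t \<otimes> r \<in> H" using mult_mem[of r t] Hc[of t] by (simp_all add: m_comm)
  qed
  have H_gcomp: "gcomp R G t a \<in> H" if "t \<in> H" for t a
    using that gcomp_homogeneous[OF gcomp_in[OF Hc[OF that], of a]] gcomp_closed
    by (auto simp: H_def)
  have deg: "\<phi> t \<in> hcomp E (int a + j)" if "t \<in> H" "t \<in> G a" for t a
    using gcomp_homogeneous[OF that(2), of n] soc[of t] that(2) \<sigma>0 E.N.component_zero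
    by (auto simp: \<phi>_def)
  have "\<exists>g\<in>hcomp E j. \<forall>t\<in>H. t \<odot>\<^bsub>E\<^esub> g = \<phi> t"
  proof (rule ideal_hom_extend[OF inj H_ideal H_gcomp _ _ _ deg])
    fix t assume t: "t \<in> H"
    show "\<phi> t \<in> carrier E" using \<sigma>c gcomp_in Hc[OF t] by (simp add: \<phi>_def)
    show "\<phi> (t \<oplus> s) = \<phi> t \<oplus>\<^bsub>E\<^esub> \<phi> s" if "s \<in> H" for s
      using Hc[OF t] Hc[OF that] gcomp_add gcomp_in assms(3) by (simp add: \<phi>_def)
    show "\<phi> (r \<otimes> t) = r \<odot>\<^bsub>E\<^esub> \<phi> t" if "r \<in> carrier R" for r
      using mult_mem[OF that t] by simp
  qed
  then obtain g where g: "g \<in> hcomp E j" "\<And>t. t \<in> H \<Longrightarrow> t \<odot>\<^bsub>E\<^esub> g = \<phi> t" by blast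
  have G_H: "t \<in> H" if "t \<in> G a" "n \<le> a" for t a
    using that component_carrier gcomp_homogeneous[OF that(1)] by (simp add: H_def)
  have "v \<odot>\<^bsub>E\<^esub> g = \<sigma> v" if "v \<in> G n" for v
    using g(2)[OF G_H[OF that]] gcomp_homogeneous[OF that] by (simp add: \<phi>_def)
  moreover have "g \<in> ann G E (Suc n)"
  proof (rule E.annI)
    show "g \<in> carrier E" using g(1) E.N.component_carrier by simp
    show "r \<odot>\<^bsub>E\<^esub> g = \<zero>\<^bsub>E\<^esub>" if "Suc n \<le> a" "r \<in> G a" for a r
      using g(2)[OF G_H[OF that(2)]] gcomp_homogeneous[OF that(2), of n] that(1) \<sigma>0
      by (simp add: \<phi>_def)
  qed
  ultimately show ?thesis using g(1) by blast
qed

end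

section \<open>Complexes of injective modules\<close>

locale inj_complex = std_graded R k G
  for R :: "'r ring" (structure) and k and G +
  fixes I :: "('r, 'e) gcomplex"
  assumes complex: "graded_complex R G I"
    and injective: "\<And>n. injective_gmodule R G (obj I n)"
begin

sublocale E: std_graded_module R k G "obj I n" for n
  using complex by (intro std_graded_moduleI) (simp add: graded_complex_def)

lemma diff_hcomp: "x \<in> hcomp (obj I n) j \<Longrightarrow> diff I n x \<in> hcomp (obj I (n - 1)) j"
  and diff_carrier: "x \<in> carrier (obj I n) \<Longrightarrow> diff I n x \<in> carrier (obj I (n - 1))"
  and diff_add: "x \<in> carrier (obj I n) \<Longrightarrow> y \<in> carrier (obj I n) \<Longrightarrow>
    diff I n (x \<oplus>\<^bsub>obj I n\<^esub> y) = diff I n x \<oplus>\<^bsub>obj I (n - 1)\<^esub> diff I n y"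
  and diff_smult: "r \<in> carrier R \<Longrightarrow> x \<in> carrier (obj I n) \<Longrightarrow>
    diff I n (r \<odot>\<^bsub>obj I n\<^esub> x) = r \<odot>\<^bsub>obj I (n - 1)\<^esub> diff I n x"
  and diff_diff: "x \<in> carrier (obj I n) \<Longrightarrow> diff I (n - 1) (diff I n x) = \<zero>\<^bsub>obj I (n - 2)\<^esub>"
  using complex by (auto simp: graded_complex_def gmod_hom_def mod_hom_def)

lemma diff_zero: "diff I n \<zero>\<^bsub>obj I n\<^esub> = \<zero>\<^bsub>obj I (n - 1)\<^esub>"
  using diff_smult[of \<zero> "\<zero>\<^bsub>obj I n\<^esub>" n] diff_carrier[of "\<zero>\<^bsub>obj I n\<^esub>" n] by simp

lemma diff_minus: "x \<in> carrier (obj I n) \<Longrightarrow> diff I n (\<ominus>\<^bsub>obj I n\<^esub> x) = \<ominus>\<^bsub>obj I (n - 1)\<^esub> diff I n x"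
  using diff_smult[of "\<ominus> \<one>" x n] diff_carrier[of x n] by (simp add: E.N.smult_l_minus)

lemma diff_Suc:
  assumes "x \<in> carrier (obj I (n + 1))"
  shows "diff I (n + 1) x \<in> carrier (obj I n)" "diff I n (diff I (n + 1) x) = \<zero>\<^bsub>obj I (n - 1)\<^esub>"
  using diff_carrier[OF assms] diff_diff[OF assms] by simp_all

lemma diff_Suc_hcomp: "x \<in> hcomp (obj I (n + 1)) j \<Longrightarrow> diff I (n + 1) x \<in> hcomp (obj I n) j"
  using diff_hcomp[of x "n + 1" j] by simp

lemma diff_ann:
  assumes "x \<in> ann G (obj I n) p"
  shows "diff I n x \<in> ann G (obj I (n - 1)) p"
proof (rule E.annI)
  have x: "x \<in> carrier (obj I n)" using assms E.ann_carrier by blast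
  show "diff I n x \<in> carrier (obj I (n - 1))" using diff_carrier[OF x] .
  fix a r assume a: "p \<le> a" "r \<in> G a"
  then have "r \<odot>\<^bsub>obj I n\<^esub> x = \<zero>\<^bsub>obj I n\<^esub>" using E.annD[OF assms] by blast
  then show "r \<odot>\<^bsub>obj I (n - 1)\<^esub> diff I n x = \<zero>\<^bsub>obj I (n - 1)\<^esub>"
    using diff_smult[OF component_carrier[OF a(2)] x] diff_zero[of n] by metis
qed

lemma diff_gcomp:
  assumes "x \<in> carrier (obj I n)"
  shows "gcomp (obj I (n - 1)) (hcomp (obj I (n - 1))) (diff I n x) j =
    diff I n (gcomp (obj I n) (hcomp (obj I n)) x j)"
  by (rule gcomp_additive_map(1)[OF E.N.graded_group_axioms E.N.graded_group_axioms assms,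
      where \<sigma> = "\<lambda>l. l"])
    (auto simp: diff_carrier diff_add diff_hcomp inj_def)

text \<open>Vanishing of the homology of the subcomplex \<open>A\<close> at homological index
  \<open>n\<close> in internal degree \<open>j\<close>, with the primitive required to be
  homogeneous too. The total degree of this spot is \<open>j - n\<close>.\<close>

definition exact_at :: "(int \<Rightarrow> 'e set) \<Rightarrow> int \<Rightarrow> int \<Rightarrow> bool" where
  "exact_at A n j \<longleftrightarrow> (\<forall>z\<in>hcomp (obj I n) j \<inter> A n. diff I n z = \<zero>\<^bsub>obj I (n - 1)\<^esub> \<longrightarrow>
     (\<exists>w\<in>hcomp (obj I (n + 1)) j \<inter> A (n + 1). diff I (n + 1) w = z))"

definition socle :: "int \<Rightarrow> 'e set" where "socle n = ann G (obj I n) 1"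

definition torsion :: "int \<Rightarrow> 'e set" where "torsion n = (\<Union>p. ann G (obj I n) p)"

text \<open>Only the multiples of \<open>u\<close> by \<open>G p\<close> are assumed to be cycles:
  in one of the two applications \<open>u\<close> is itself a primitive and need not be a cycle.
  These multiples lie in the socle, as \<open>u\<close> is killed above degree \<open>p\<close>, so
  \<open>ex\<close> supplies socle primitives. \<open>socle_map_extend\<close> turns a linear choice
  of them into one element \<open>g\<close>.\<close>

lemma descent:
  assumes u: "u \<in> hcomp (obj I n) j" "u \<in> ann G (obj I n) (Suc p)"
    and cyc: "\<And>v. v \<in> G p \<Longrightarrow> diff I n (v \<odot>\<^bsub>obj I n\<^esub> u) = \<zero>\<^bsub>obj I (n - 1)\<^esub>"
    and ex: "exact_at socle n (int p + j)"
  shows "\<exists>g\<in>hcomp (obj I (n + 1)) j \<inter> ann G (obj I (n + 1)) (Suc p).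
    u \<ominus>\<^bsub>obj I n\<^esub> diff I (n + 1) g \<in> ann G (obj I n) p"
proof -
  let ?E = "obj I (n + 1)"
  define P where "P v s \<longleftrightarrow> v \<in> G p \<and> s \<in> ann G ?E 1 \<and> s \<in> hcomp ?E (int p + j) \<and>
    diff I (n + 1) s = v \<odot>\<^bsub>obj I n\<^esub> u" for v s
  have PD: "v \<in> G p" "s \<in> ann G ?E 1" "s \<in> hcomp ?E (int p + j)"
    "diff I (n + 1) s = v \<odot>\<^bsub>obj I n\<^esub> u" "v \<in> carrier R" "s \<in> carrier ?E" if "P v s" for v s
    using that component_carrier[of v p] E.ann_carrier[of s "n + 1" 1] by (simp_all add: P_def)
  have uc: "u \<in> carrier (obj I n)" using u(2) E.ann_carrier by blast
  have Pex: "\<exists>s. P v s" if v: "v \<in> G p" for v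
  proof -
    have "v \<odot>\<^bsub>obj I n\<^esub> u \<in> socle n"
      using E.G_smult_ann[OF v, of u n 1] u(2) by (simp add: socle_def)
    then obtain s where "s \<in> hcomp ?E (int p + j)" "s \<in> socle (n + 1)"
      "diff I (n + 1) s = v \<odot>\<^bsub>obj I n\<^esub> u"
      using ex cyc[OF v] E.G_smult[OF v u(1)] unfolding exact_at_def by blast
    then show ?thesis using v by (auto simp: P_def socle_def)
  qed
  \<comment> \<open>A basis of \<open>G p\<close> is extracted from the monomials of degree
    \<open>p\<close>, since \<open>linear_selection\<close> works along independent vectors.\<close>
  obtain Us where Us: "set Us \<subseteq> carrier R" "independent k Us" "Span k Us = G p"
    using filter_base[OF subfield_k monomials_carrier[of p]] G_eq_msp[of p] msp_def[of p] by metis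
  interpret A: additive_subgroup "ann G ?E 1" ?E by (rule E.ann_subgroup)
  have "\<exists>\<sigma>. (\<forall>v\<in>Span k Us. P v (\<sigma> v)) \<and>
    (\<forall>v\<in>Span k Us. \<forall>w\<in>Span k Us. \<sigma> (v \<oplus> w) = \<sigma> v \<oplus>\<^bsub>?E\<^esub> \<sigma> w) \<and>
    (\<forall>c\<in>k. \<forall>v\<in>Span k Us. \<sigma> (c \<otimes> v) = c \<odot>\<^bsub>?E\<^esub> \<sigma> v)"
  proof (rule linear_selection)
    show "module R ?E" by (rule E.N.module_axioms)
    show "P \<zero> \<zero>\<^bsub>?E\<^esub>"
      unfolding P_def using uc component_zero E.N.component_zero diff_zero[of "n + 1"] A.zero_closed
      by simp
    show "\<exists>s. P v s" if "v \<in> set Us" for v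
      using Pex Span_base_incl[OF subfield_k Us(1)] Us(3) that by blast
    fix v s assume vs: "P v s"
    note vsD = PD[OF vs]
    show "s \<in> carrier ?E" by (rule vsD)
    show "P (c \<otimes> v) (c \<odot>\<^bsub>?E\<^esub> s)" if c: "c \<in> k" for c
    proof -
      have cR: "c \<in> carrier R" and c0: "c \<in> G 0" using c k_carrier G_0 by auto
      have "diff I (n + 1) (c \<odot>\<^bsub>?E\<^esub> s) = (c \<otimes> v) \<odot>\<^bsub>obj I n\<^esub> u"
        using diff_smult[OF cR vsD(6)] vsD(4,5) cR uc by (simp add: E.N.smult_assoc1)
      moreover have "c \<otimes> v \<in> G p" using G_mult[OF c0 vsD(1)] by simp
      moreover have "c \<odot>\<^bsub>?E\<^esub> s \<in> hcomp ?E (int p + j)" using E.G_smult[OF c0 vsD(3)] by simp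
      ultimately show ?thesis unfolding P_def using E.ann_smult[OF cR vsD(2)] by blast
    qed
    fix w t assume wt: "P w t"
    note wtD = PD[OF wt]
    have "diff I (n + 1) (s \<oplus>\<^bsub>?E\<^esub> t) = (v \<oplus> w) \<odot>\<^bsub>obj I n\<^esub> u"
      using diff_add[OF vsD(6) wtD(6)] vsD(4,5) wtD(4,5) uc by (simp add: E.N.smult_l_distr)
    then show "P (v \<oplus> w) (s \<oplus>\<^bsub>?E\<^esub> t)"
      unfolding P_def using component_add[OF vsD(1) wtD(1)] E.N.component_add[OF vsD(3) wtD(3)]
        A.a_closed[OF vsD(2) wtD(2)] by blast
  qed (use subfield_k Us in auto)
  then obtain \<sigma> where \<sigma>: "\<And>v. v \<in> G p \<Longrightarrow> P v (\<sigma> v)"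
    "\<And>v w. v \<in> G p \<Longrightarrow> w \<in> G p \<Longrightarrow> \<sigma> (v \<oplus> w) = \<sigma> v \<oplus>\<^bsub>?E\<^esub> \<sigma> w"
    "\<And>c v. c \<in> k \<Longrightarrow> v \<in> G p \<Longrightarrow> \<sigma> (c \<otimes> v) = c \<odot>\<^bsub>?E\<^esub> \<sigma> v"
    unfolding Us(3) by blast
  have "\<exists>g\<in>hcomp ?E j \<inter> ann G ?E (Suc p). \<forall>v\<in>G p. v \<odot>\<^bsub>?E\<^esub> g = \<sigma> v"
    by (rule socle_map_extend[OF injective _ \<sigma>(2,3)]) (use \<sigma>(1) PD(2,3) in blast)+
  then obtain g where g: "g \<in> hcomp ?E j" "g \<in> ann G ?E (Suc p)"
    "\<And>v. v \<in> G p \<Longrightarrow> v \<odot>\<^bsub>?E\<^esub> g = \<sigma> v" by blast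
  have gc: "g \<in> carrier (obj I (n + 1))" using g(2) E.ann_carrier by simp
  have dg: "diff I (n + 1) g \<in> carrier (obj I n)" using diff_Suc(1)[OF gc] .
  have "u \<ominus>\<^bsub>obj I n\<^esub> diff I (n + 1) g \<in> ann G (obj I n) p"
  proof (rule E.annI)
    show "u \<ominus>\<^bsub>obj I n\<^esub> diff I (n + 1) g \<in> carrier (obj I n)" using uc dg by simp
    fix a r assume a: "p \<le> a" "r \<in> G a"
    then have r: "r \<in> carrier R" using component_carrier by simp
    \<comment> \<open>In degree \<open>p\<close> this is the choice of primitives; in higher degrees
      both \<open>u\<close> and \<open>g\<close> are killed.\<close>
    have "r \<odot>\<^bsub>obj I n\<^esub> u = diff I (n + 1) (r \<odot>\<^bsub>obj I (n + 1)\<^esub> g)"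
    proof (cases "a = p")
      case True
      then show ?thesis using g(3)[of r] PD(4)[OF \<sigma>(1)[of r]] a by simp
    next
      case False
      then show ?thesis
        using E.annD[OF u(2), of a r] E.annD[OF g(2), of a r] a diff_zero[of "n + 1"] by simp
    qed
    then have "r \<odot>\<^bsub>obj I n\<^esub> u = r \<odot>\<^bsub>obj I n\<^esub> diff I (n + 1) g"
      using diff_smult[OF r gc] by simp
    then show "r \<odot>\<^bsub>obj I n\<^esub> (u \<ominus>\<^bsub>obj I n\<^esub> diff I (n + 1) g) = \<zero>\<^bsub>obj I n\<^esub>"
      using r uc dg by (simp add: E.N.M.minus_eq E.N.smult_r_distr E.N.smult_r_minus E.N.M.r_neg)
  qed
  then show ?thesis using g by blast
qed

text \<open>Each descent replaces the cycle by a homologous one of the next lower level, until it is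
  zero at level 0. Every descent is covered by \<open>soc\<close>, since the multiples involved have
  total degree \<open>p + j - n\<close>, which is at least \<open>j - n\<close>.\<close>

lemma torsion_exact_if_socle_exact:
  assumes soc: "\<And>n j. r < j - n \<Longrightarrow> exact_at socle n j" and "r < j - n"
  shows "exact_at torsion n j"
proof -
  have "\<exists>w\<in>hcomp (obj I (n + 1)) j \<inter> ann G (obj I (n + 1)) p. diff I (n + 1) w = z"
    if "z \<in> hcomp (obj I n) j" "z \<in> ann G (obj I n) p" "diff I n z = \<zero>\<^bsub>obj I (n - 1)\<^esub>" for z p
    using that
  proof (induction p arbitrary: z)
    case 0
    have "\<one> \<odot>\<^bsub>obj I n\<^esub> z = \<zero>\<^bsub>obj I n\<^esub>" using E.annD[OF 0(2), of 0 \<one>] one_G_0 by simp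
    then have "z = \<zero>\<^bsub>obj I n\<^esub>" using E.ann_carrier[OF 0(2)] by simp
    moreover have "\<zero>\<^bsub>obj I (n + 1)\<^esub> \<in> ann G (obj I (n + 1)) 0"
      using additive_subgroup.zero_closed[OF E.ann_subgroup] .
    ultimately show ?case
      using E.N.component_zero diff_zero[of "n + 1"] by (intro bexI[of _ "\<zero>\<^bsub>obj I (n + 1)\<^esub>"]) auto
  next
    case (Suc p)
    have zc: "z \<in> carrier (obj I n)" using Suc.prems E.ann_carrier by simp
    have "diff I n (v \<odot>\<^bsub>obj I n\<^esub> z) = \<zero>\<^bsub>obj I (n - 1)\<^esub>" if "v \<in> G p" for v
      using diff_smult[OF component_carrier[OF that] zc] Suc.prems(3) component_carrier[OF that]
      by simp
    then obtain g where g: "g \<in> hcomp (obj I (n + 1)) j" "g \<in> ann G (obj I (n + 1)) (Suc p)"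
      "z \<ominus>\<^bsub>obj I n\<^esub> diff I (n + 1) g \<in> ann G (obj I n) p"
      using descent[OF Suc.prems(1,2)] soc[of "int p + j" n] \<open>r < j - n\<close> by auto
    have gc: "g \<in> carrier (obj I (n + 1))" using g(2) E.ann_carrier by simp
    note dg = diff_Suc[OF gc]
    have "z \<ominus>\<^bsub>obj I n\<^esub> diff I (n + 1) g \<in> hcomp (obj I n) j"
      using Suc.prems(1) diff_Suc_hcomp[OF g(1)] E.N.component_add E.N.component_minus
      by (simp add: E.N.M.minus_eq)
    moreover have "diff I n (z \<ominus>\<^bsub>obj I n\<^esub> diff I (n + 1) g) = \<zero>\<^bsub>obj I (n - 1)\<^esub>"
      using zc dg diff_add[of z n] diff_minus[OF dg(1)] Suc.prems(3) by (simp add: E.N.M.minus_eq)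
    ultimately obtain w where w: "w \<in> hcomp (obj I (n + 1)) j" "w \<in> ann G (obj I (n + 1)) p"
      "diff I (n + 1) w = z \<ominus>\<^bsub>obj I n\<^esub> diff I (n + 1) g"
      using Suc.IH[OF _ g(3)] by blast
    have wc: "w \<in> carrier (obj I (n + 1))" using w(2) E.ann_carrier by simp
    have "diff I (n + 1) (w \<oplus>\<^bsub>obj I (n + 1)\<^esub> g) = z"
      using diff_add[OF wc gc] w(3) zc dg(1)
      by (simp add: E.N.M.minus_eq E.N.M.a_assoc E.N.M.l_neg)
    moreover have "w \<oplus>\<^bsub>obj I (n + 1)\<^esub> g \<in> ann G (obj I (n + 1)) (Suc p)"
      using additive_subgroup.a_closed[OF E.ann_subgroup] g(2) E.ann_mono[OF w(2)] by simp
    ultimately show ?case using E.N.component_add[OF w(1) g(1)] by blast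
  qed
  then show ?thesis unfolding exact_at_def torsion_def by blast
qed

text \<open>The outer induction moves \<open>n\<close> down from the bound \<open>b\<close>, above
  which the complex vanishes. For fixed \<open>n\<close> an inner induction lowers the level of a
  torsion primitive \<open>w\<close> of the cycle to 1, using socle exactness at
  \<open>n + 1\<close>.\<close>

lemma socle_exact_if_torsion_exact:
  assumes bounded: "\<And>n. b < n \<Longrightarrow> carrier (obj I n) = {\<zero>\<^bsub>obj I n\<^esub>}"
    and tor: "\<And>n j. r < j - n \<Longrightarrow> exact_at torsion n j" and "r < j - n"
  shows "exact_at socle n j"
proof -
  have "exact_at socle n j" if "b - n < int m" "r < j - n" for m n j
    using that
  proof (induction m arbitrary: n j)
    case 0
    then have "b < n" "b < n + 1" by simp_all
    note zero = this[THEN bounded]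
    have "z = \<zero>\<^bsub>obj I n\<^esub>" if "z \<in> socle n" for z
      using that zero(1) E.ann_carrier by (auto simp: socle_def)
    moreover have "\<zero>\<^bsub>obj I (n + 1)\<^esub> \<in> socle (n + 1)"
      using additive_subgroup.zero_closed[OF E.ann_subgroup] by (simp add: socle_def)
    ultimately show ?case
      using E.N.component_zero diff_zero[of "n + 1"] unfolding exact_at_def
      by (intro ballI impI bexI[of _ "\<zero>\<^bsub>obj I (n + 1)\<^esub>"]) auto
  next
    case (Suc m)
    note exact_above = Suc.IH
    show ?case
      unfolding exact_at_def
    proof (intro ballI impI)
      fix z assume z: "z \<in> hcomp (obj I n) j \<inter> socle n" and dz: "diff I n z = \<zero>\<^bsub>obj I (n - 1)\<^esub>"
      have killed: "v \<odot>\<^bsub>obj I n\<^esub> z = \<zero>\<^bsub>obj I n\<^esub>" if "v \<in> G a" "1 \<le> a" for v a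
        using z E.annD[OF _ that(2,1)] by (simp add: socle_def)
      have "z \<in> torsion n" using z by (auto simp: socle_def torsion_def)
      then obtain w p where "w \<in> hcomp (obj I (n + 1)) j" "w \<in> ann G (obj I (n + 1)) p"
        "diff I (n + 1) w = z"
        using tor[OF Suc.prems(2)] z dz unfolding exact_at_def torsion_def by blast
      then have "\<exists>w\<in>hcomp (obj I (n + 1)) j \<inter> ann G (obj I (n + 1)) 1. diff I (n + 1) w = z"
      proof (induction p arbitrary: w)
        case 0
        then show ?case using E.ann_mono[of w "n + 1" 0 1] by blast
      next
        case (Suc p)
        show ?case
        proof (cases "p = 0")
          \<comment> \<open>Level 1 is the target. One more descent would need all multiples of
            \<open>w\<close> by \<open>G 0\<close>, among them \<open>w\<close> itself, to be
            cycles, whereas \<open>w\<close> is mapped to \<open>z\<close>.\<close>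
          case True
          then show ?thesis using Suc.prems by auto
        next
          case False
          have wc: "w \<in> carrier (obj I (n + 1))" using Suc.prems E.ann_carrier by simp
          \<comment> \<open>Passing to \<open>n + 1\<close> costs one in total degree, which is
            regained because \<open>p\<close> is at least 1.\<close>
          have "exact_at socle (n + 1) (int p + j)"
            using False \<open>b - n < int (Suc m)\<close> \<open>r < j - n\<close> by (intro exact_above) auto
          \<comment> \<open>The differential sends the multiple to \<open>v\<close> times
            \<open>z\<close>, and \<open>v\<close> has positive degree while \<open>z\<close> lies
            in the socle.\<close>
          moreover have "diff I (n + 1) (v \<odot>\<^bsub>obj I (n + 1)\<^esub> w) = \<zero>\<^bsub>obj I (n + 1 - 1)\<^esub>"
            if "v \<in> G p" for v
            using diff_smult[OF component_carrier[OF that] wc] killed[OF that] False Suc.prems(3)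
            by simp
          ultimately obtain g where g: "g \<in> hcomp (obj I (n + 1 + 1)) j"
            "g \<in> ann G (obj I (n + 1 + 1)) (Suc p)"
            "w \<ominus>\<^bsub>obj I (n + 1)\<^esub> diff I (n + 1 + 1) g \<in> ann G (obj I (n + 1)) p"
            using descent[OF Suc.prems(1,2)] by blast
          have gc: "g \<in> carrier (obj I (n + 1 + 1))" using g(2) E.ann_carrier by simp
          note dg = diff_Suc[OF gc]
          have "w \<ominus>\<^bsub>obj I (n + 1)\<^esub> diff I (n + 1 + 1) g \<in> hcomp (obj I (n + 1)) j"
            using Suc.prems(1) diff_Suc_hcomp[OF g(1)] E.N.component_add E.N.component_minus
            by (simp add: E.N.M.minus_eq)
          moreover have "diff I (n + 1) (w \<ominus>\<^bsub>obj I (n + 1)\<^esub> diff I (n + 1 + 1) g) = z"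
            using diff_add[OF wc] diff_minus[OF dg(1)] dg Suc.prems(3) diff_Suc(1)[OF wc]
            by (simp add: E.N.M.minus_eq)
          ultimately show ?thesis using Suc.IH[OF _ g(3)] by blast
        qed
      qed
      then show "\<exists>w\<in>hcomp (obj I (n + 1)) j \<inter> socle (n + 1). diff I (n + 1) w = z"
        by (simp add: socle_def)
    qed
  qed
  \<comment> \<open>This value satisfies \<open>b - n < int m\<close> for every \<open>n\<close>,
    also for those far above \<open>b\<close>, where it is 0.\<close>
  from this[of n "nat (b - n + 1)" j] show ?thesis using \<open>r < j - n\<close> by simp
qed

end

section \<open>The residue field\<close>

context std_graded
begin

interpretation mm: ideal mm R by (rule mm_ideal)

definition cls :: "'r \<Rightarrow> 'r set" where "cls r = mm +> r"

abbreviation \<kappa> :: "('r, 'r set) gmodule" where "\<kappa> \<equiv> residue_field R G"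

lemma cls_eq_iff: "r \<in> carrier R \<Longrightarrow> s \<in> carrier R \<Longrightarrow> cls r = cls s \<longleftrightarrow> r \<ominus> s \<in> mm"
  unfolding cls_def by (rule quotient_eq_iff_same_a_r_cos[OF mm_ideal, symmetric])

lemma mem_cls:
  assumes "r \<in> carrier R" "x \<in> cls r"
  shows "x \<in> carrier R" "cls x = cls r"
proof -
  obtain h where h: "h \<in> mm" "x = h \<oplus> r" using assms(2) by (auto simp: cls_def a_r_coset_def')
  then have hc: "h \<in> carrier R" using mm.Icarr by blast
  show x: "x \<in> carrier R" using h hc assms(1) by simp
  have "x \<ominus> r = h" unfolding h(2) using hc assms(1) by algebra
  then show "cls x = cls r" using cls_eq_iff[OF x assms(1)] h(1) by simp
qed

lemma self_cls: "r \<in> carrier R \<Longrightarrow> r \<in> cls r"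
  unfolding cls_def by (rule mm.a_rcos_self)

lemma ring_gmodule_coset: "mm +>\<^bsub>ring_gmodule R G\<^esub> r = cls r"
  by (simp only: a_r_coset_def' ring_gmodule_def cls_def ring.select_convs)

lemma residue_field_carrier: "carrier \<kappa> = cls ` carrier R"
proof -
  have "carrier (ring_gmodule R G) = carrier R" by (simp add: ring_gmodule_def)
  then show ?thesis
    by (auto simp add: residue_field_def quot_gmodule_def A_RCOSETS_def' ring_gmodule_coset)
qed

lemma residue_field_hcomp: "hcomp \<kappa> l = cls ` (if l \<ge> 0 then G (nat l) else {\<zero>})"
proof -
  have "hcomp (ring_gmodule R G) l = (if l \<ge> 0 then G (nat l) else {\<zero>})"
    by (simp add: ring_gmodule_def)
  then show ?thesis by (simp add: residue_field_def quot_gmodule_def ring_gmodule_coset)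
qed

lemma residue_field_add:
  assumes "r \<in> carrier R" "s \<in> carrier R"
  shows "cls r \<oplus>\<^bsub>\<kappa>\<^esub> cls s = cls (r \<oplus> s)"
proof -
  have "cls r \<oplus>\<^bsub>\<kappa>\<^esub> cls s = cls r <+> cls s"
    by (simp add: residue_field_def quot_gmodule_def set_add_def' ring_gmodule_def)
  then show ?thesis unfolding cls_def using mm.a_rcos_sum[OF assms] by simp
qed

text \<open>\<open>quot_gmodule\<close> takes a union over all representatives of the class. Their
  products with \<open>r\<close> are congruent modulo \<open>mm\<close>, so the union is a single
  class.\<close>

lemma residue_field_smult:
  assumes "r \<in> carrier R" "s \<in> carrier R"
  shows "r \<odot>\<^bsub>\<kappa>\<^esub> cls s = cls (r \<otimes> s)"
proof -
  have rep: "cls (r \<otimes> x) = cls (r \<otimes> s)" if "x \<in> cls s" for x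
  proof -
    have x: "x \<in> carrier R" "x \<ominus> s \<in> mm" using mem_cls[OF assms(2) that] cls_eq_iff assms by auto
    then have "r \<otimes> (x \<ominus> s) \<in> mm" using mm.I_l_closed assms by blast
    moreover have "r \<otimes> (x \<ominus> s) = r \<otimes> x \<ominus> r \<otimes> s" using x assms by algebra
    ultimately show ?thesis using cls_eq_iff x assms by simp
  qed
  have "smult (ring_gmodule R G) = mult R" by (simp add: ring_gmodule_def)
  then have "r \<odot>\<^bsub>\<kappa>\<^esub> cls s = (\<Union>x\<in>cls s. cls (r \<otimes> x))"
    by (simp add: residue_field_def quot_gmodule_def ring_gmodule_coset)
  also have "\<dots> = (\<Union>x\<in>cls s. cls (r \<otimes> s))" by (rule SUP_cong[OF refl rep])
  also have "\<dots> = cls (r \<otimes> s)" using self_cls[OF assms(2)] by blast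
  finally show ?thesis .
qed

lemma one_residue_field: "cls \<one> \<in> hcomp \<kappa> 0"
  using one_G_0 by (simp add: residue_field_hcomp)

end

section \<open>Graded homomorphisms out of the residue field\<close>

context std_graded_module
begin

text \<open>The map induced on the residue field by multiplication on \<open>s\<close>. The
  arbitrary representative is harmless for \<open>s\<close> in the socle, see
  \<open>soc_map_cls\<close>; restriction to the carrier matches the extensional maps in
  \<open>graded_Hom\<close>.\<close>

definition soc_map :: "'m \<Rightarrow> 'r set \<Rightarrow> 'm" where
  "soc_map s = (\<lambda>X\<in>carrier \<kappa>. (SOME r. r \<in> carrier R \<and> cls r = X) \<odot>\<^bsub>N\<^esub> s)"

lemma soc_map_cls:
  assumes s: "s \<in> ann G N 1" and r: "r \<in> carrier R"
  shows "soc_map s (cls r) = r \<odot>\<^bsub>N\<^esub> s"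
proof -
  have sc: "s \<in> carrier N" using s ann_carrier by blast
  define t where "t = (SOME t. t \<in> carrier R \<and> cls t = cls r)"
  have t: "t \<in> carrier R" "cls t = cls r"
    using someI[of "\<lambda>t. t \<in> carrier R \<and> cls t = cls r" r] r by (auto simp: t_def)
  then have "t \<ominus> r \<in> mm" using cls_eq_iff r by blast
  then have "(t \<ominus> r) \<odot>\<^bsub>N\<^esub> s = \<zero>\<^bsub>N\<^esub>" using ann_1_iff s by blast
  moreover have "t = (t \<ominus> r) \<oplus> r" using t r by algebra
  then have "t \<odot>\<^bsub>N\<^esub> s = (t \<ominus> r) \<odot>\<^bsub>N\<^esub> s \<oplus>\<^bsub>N\<^esub> r \<odot>\<^bsub>N\<^esub> s"
    using N.smult_l_distr[of "t \<ominus> r" r s] t r sc by simp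
  ultimately have "t \<odot>\<^bsub>N\<^esub> s = r \<odot>\<^bsub>N\<^esub> s" using r sc by simp
  then show ?thesis using r by (simp add: soc_map_def residue_field_carrier t_def)
qed

lemma soc_map_extensional: "soc_map s \<in> extensional (carrier \<kappa>)"
  by (simp add: soc_map_def)

lemma soc_map_one: "s \<in> ann G N 1 \<Longrightarrow> soc_map s (cls \<one>) = s"
  using soc_map_cls[of s \<one>] ann_carrier by simp

lemma eq_soc_map:
  assumes "f \<in> extensional (carrier \<kappa>)" "s \<in> ann G N 1"
    and "\<And>r. r \<in> carrier R \<Longrightarrow> f (cls r) = r \<odot>\<^bsub>N\<^esub> s"
  shows "f = soc_map s"
proof (rule extensionalityI[OF assms(1) soc_map_extensional])
  fix X assume "X \<in> carrier \<kappa>"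
  then show "f X = soc_map s X"
    using assms(3) soc_map_cls[OF assms(2)] by (auto simp: residue_field_carrier)
qed

lemma soc_map_hom:
  assumes "s \<in> ann G N 1" "s \<in> hcomp N j"
  shows "soc_map s \<in> gmod_hom R \<kappa> N j"
proof -
  have sc: "s \<in> carrier N" using assms ann_carrier by blast
  have "soc_map s ` hcomp \<kappa> a \<subseteq> hcomp N (a + j)" for a
    using soc_map_cls[OF assms(1)] G_smult[OF _ assms(2), of _ "nat a"] component_carrier sc
      N.component_zero by (auto simp: residue_field_hcomp)
  then show ?thesis
    using soc_map_cls[OF assms(1)] sc
    by (auto simp: gmod_hom_def mod_hom_def residue_field_carrier residue_field_add
        residue_field_smult N.smult_l_distr N.smult_assoc1)
qed

text \<open>The class of \<open>\<one>\<close> generates the residue field and is killed by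
  \<open>mm\<close>, so its image lies in the socle and determines \<open>f\<close>.\<close>

lemma hom_residue_field:
  assumes "f \<in> gmod_hom R \<kappa> N j"
  shows "f (cls \<one>) \<in> ann G N 1" "f (cls \<one>) \<in> hcomp N j"
    "\<And>r. r \<in> carrier R \<Longrightarrow> f (cls r) = r \<odot>\<^bsub>N\<^esub> f (cls \<one>)"
proof -
  have one: "cls \<one> \<in> carrier \<kappa>" by (simp add: residue_field_carrier)
  have fc: "f (cls \<one>) \<in> carrier N" using assms one by (auto simp: gmod_hom_def mod_hom_def)
  show deg: "f (cls \<one>) \<in> hcomp N j"
    using assms one_residue_field unfolding gmod_hom_def by fastforce
  show lin: "f (cls r) = r \<odot>\<^bsub>N\<^esub> f (cls \<one>)" if "r \<in> carrier R" for r
  proof -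
    have "f (r \<odot>\<^bsub>\<kappa>\<^esub> cls \<one>) = r \<odot>\<^bsub>N\<^esub> f (cls \<one>)"
      using assms one that unfolding gmod_hom_def mod_hom_def by blast
    then show ?thesis using residue_field_smult[of r \<one>] that by simp
  qed
  have "r \<odot>\<^bsub>N\<^esub> f (cls \<one>) = \<zero>\<^bsub>N\<^esub>" if "r \<in> mm" for r
  proof -
    have r: "r \<in> carrier R" using ideal.Icarr[OF mm_ideal that] .
    have "cls r = cls \<zero>" using cls_eq_iff[OF r zero_closed] that r by (simp add: minus_eq)
    then show ?thesis using lin[OF r] lin[OF zero_closed] fc by simp
  qed
  then show "f (cls \<one>) \<in> ann G N 1" using ann_1_iff fc by blast
qed

abbreviation Hom_k :: "('r, 'r set \<Rightarrow> 'm) gmodule" where "Hom_k \<equiv> graded_Hom R \<kappa> N"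

lemma graded_Hom_simps:
  "zero Hom_k = (\<lambda>x\<in>carrier \<kappa>. \<zero>\<^bsub>N\<^esub>)"
  "add Hom_k = (\<lambda>f g. \<lambda>x\<in>carrier \<kappa>. f x \<oplus>\<^bsub>N\<^esub> g x)"
  by (simp_all add: graded_Hom_def)

lemma soc_map_add:
  assumes "s \<in> ann G N 1" "t \<in> ann G N 1"
  shows "soc_map s \<oplus>\<^bsub>Hom_k\<^esub> soc_map t = soc_map (s \<oplus>\<^bsub>N\<^esub> t)"
proof (rule eq_soc_map)
  show "s \<oplus>\<^bsub>N\<^esub> t \<in> ann G N 1" using additive_subgroup.a_closed[OF ann_subgroup assms] .
  show "soc_map s \<oplus>\<^bsub>Hom_k\<^esub> soc_map t \<in> extensional (carrier \<kappa>)" by (simp add: graded_Hom_simps)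
  fix r assume "r \<in> carrier R"
  then show "(soc_map s \<oplus>\<^bsub>Hom_k\<^esub> soc_map t) (cls r) = r \<odot>\<^bsub>N\<^esub> (s \<oplus>\<^bsub>N\<^esub> t)"
    using assms ann_carrier soc_map_cls
    by (simp add: graded_Hom_simps residue_field_carrier N.smult_r_distr)
qed

lemma graded_Hom_zero: "\<zero>\<^bsub>Hom_k\<^esub> = soc_map \<zero>\<^bsub>N\<^esub>"
  by (rule eq_soc_map)
    (use additive_subgroup.zero_closed[OF ann_subgroup] in
      \<open>auto simp: graded_Hom_simps residue_field_carrier\<close>)

lemma graded_Hom_hcomp: "hcomp Hom_k j = soc_map ` (ann G N 1 \<inter> hcomp N j)"
proof (intro subset_antisym subsetI)
  fix f assume "f \<in> hcomp Hom_k j"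
  then have f: "f \<in> gmod_hom R \<kappa> N j" "f \<in> extensional (carrier \<kappa>)" by (simp_all add: graded_Hom_def)
  note hom = hom_residue_field[OF f(1)]
  show "f \<in> soc_map ` (ann G N 1 \<inter> hcomp N j)"
    using eq_soc_map[OF f(2) hom(1) hom(3)] hom(1,2) by blast
qed (use soc_map_hom soc_map_extensional in \<open>auto simp: graded_Hom_def\<close>)

text \<open>A finite sum of homogeneous maps takes the class of \<open>\<one>\<close> to a sum of
  socle elements. Conversely the components of a socle element stay in the socle by
  \<open>ann_gcomp\<close> and give the finite sum of homogeneous maps that
  \<open>graded_Hom\<close> demands.\<close>

lemma graded_Hom_carrier: "carrier Hom_k = soc_map ` ann G N 1"
proof (intro subset_antisym subsetI)
  interpret A: additive_subgroup "ann G N 1" N by (rule ann_subgroup)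
  fix f assume "f \<in> carrier Hom_k"
  then obtain J c where f: "f \<in> extensional (carrier \<kappa>)" "finite J"
    "\<And>j. j \<in> J \<Longrightarrow> c j \<in> gmod_hom R \<kappa> N j" "\<And>x. x \<in> carrier \<kappa> \<Longrightarrow> f x = (\<Oplus>\<^bsub>N\<^esub>j\<in>J. c j x)"
    by (auto simp: graded_Hom_def)
  note hom = hom_residue_field[OF f(3)]
  have c: "c j (cls \<one>) \<in> carrier N" if "j \<in> J" for j using hom(1)[OF that] ann_carrier by blast
  define s where "s = (\<Oplus>\<^bsub>N\<^esub>j\<in>J. c j (cls \<one>))"
  have fr: "f (cls r) = r \<odot>\<^bsub>N\<^esub> s" if "r \<in> carrier R" for r
  proof -
    have "f (cls r) = (\<Oplus>\<^bsub>N\<^esub>j\<in>J. c j (cls r))" using f(4) that by (simp add: residue_field_carrier)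
    also have "\<dots> = (\<Oplus>\<^bsub>N\<^esub>j\<in>J. r \<odot>\<^bsub>N\<^esub> c j (cls \<one>))"
    proof (rule N.M.finsum_cong')
      show "c j (cls r) = r \<odot>\<^bsub>N\<^esub> c j (cls \<one>)" if "j \<in> J" for j
        using hom(3)[OF that \<open>r \<in> carrier R\<close>] .
    qed (use c that in auto)
    also have "\<dots> = r \<odot>\<^bsub>N\<^esub> s"
      unfolding s_def using N.finsum_smult_ldistr[OF f(2) that, of "\<lambda>j. c j (cls \<one>)"] c by simp
    finally show ?thesis .
  qed
  have "(\<Oplus>\<^bsub>N\<^esub>j\<in>F. c j (cls \<one>)) \<in> ann G N 1" if "finite F" "F \<subseteq> J" for F
    using that
  proof (induction F)
    case (insert j F)
    then show ?case using hom(1) c A.a_closed by (simp add: Pi_def subset_iff)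
  qed (use A.zero_closed in simp)
  then have "s \<in> ann G N 1" using f(2) by (simp add: s_def)
  then show "f \<in> soc_map ` ann G N 1" using eq_soc_map[OF f(1) _ fr] by blast
next
  fix f assume "f \<in> soc_map ` ann G N 1"
  then obtain s where s: "s \<in> ann G N 1" "f = soc_map s" by blast
  have sc: "s \<in> carrier N" using s ann_carrier by blast
  define J where "J = {j. gcomp N (hcomp N) s j \<noteq> \<zero>\<^bsub>N\<^esub>}"
  define c where "c j = soc_map (gcomp N (hcomp N) s j)" for j
  have comp: "gcomp N (hcomp N) s j \<in> ann G N 1" for j using ann_gcomp[OF s(1)] .
  have "c j \<in> gmod_hom R \<kappa> N j" for j
    unfolding c_def using soc_map_hom[OF comp N.gcomp_in[OF sc]] .
  moreover have "f x = (\<Oplus>\<^bsub>N\<^esub>j\<in>J. c j x)" if x: "x \<in> carrier \<kappa>" for x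
  proof -
    obtain r where r: "r \<in> carrier R" "x = cls r" using x by (auto simp: residue_field_carrier)
    have "f x = r \<odot>\<^bsub>N\<^esub> (\<Oplus>\<^bsub>N\<^esub>j\<in>J. gcomp N (hcomp N) s j)"
      using soc_map_cls[OF s(1) r(1)] N.gcomp_spec[OF sc] s r by (simp add: J_def)
    also have "\<dots> = (\<Oplus>\<^bsub>N\<^esub>j\<in>J. r \<odot>\<^bsub>N\<^esub> gcomp N (hcomp N) s j)"
      by (rule N.finsum_smult_ldistr) (use N.gcomp_finite N.gcomp_closed sc r in \<open>auto simp: J_def\<close>)
    also have "\<dots> = (\<Oplus>\<^bsub>N\<^esub>j\<in>J. c j x)" using soc_map_cls[OF comp r(1)] r by (simp add: c_def)
    finally show ?thesis .
  qed
  moreover have "finite J" using N.gcomp_finite[OF sc] by (simp add: J_def)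
  ultimately show "f \<in> carrier Hom_k"
    using soc_map_extensional s(2) unfolding graded_Hom_def by auto
qed

end

section \<open>Regularity through homogeneous cycles\<close>

lemma image_eq_singleton_iff: "S \<noteq> {} \<Longrightarrow> f ` S = {b} \<longleftrightarrow> (\<forall>x\<in>S. f x = b)"
  by auto

text \<open>The degree \<open>j\<close> part of homology is the image of the homogeneous cycles
  under the coset map. The first assumption excludes an empty image, which would also differ from
  the zero component; the second is supplied separately by the two complexes.\<close>

lemma homology_hcomp_nonzero_iff:
  assumes "hcomp (obj X n) j \<inter> cycles X n \<noteq> {}"
    and "\<And>x. x \<in> hcomp (obj X n) j \<inter> cycles X n \<Longrightarrow>
      boundaries X n +>\<^bsub>obj X n\<^esub> x = boundaries X n \<longleftrightarrow> x \<in> boundaries X n"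
  shows "hcomp (homology X n) j \<noteq> {\<zero>\<^bsub>homology X n\<^esub>} \<longleftrightarrow>
    (\<exists>x\<in>hcomp (obj X n) j \<inter> cycles X n. x \<notin> boundaries X n)"
proof -
  let ?S = "hcomp (obj X n) j \<inter> cycles X n"
  have "hcomp (homology X n) j =
      (\<lambda>x. boundaries X n +>\<^bsub>obj X n\<^esub> x) ` (hcomp (obj X n) j \<inter> cycles X n)"
    and "\<zero>\<^bsub>homology X n\<^esub> = boundaries X n"
    unfolding homology_def quot_gmodule_def sub_gmodule_def a_r_coset_def' by simp_all
  then have "hcomp (homology X n) j = {\<zero>\<^bsub>homology X n\<^esub>} \<longleftrightarrow>
      (\<forall>x\<in>?S. boundaries X n +>\<^bsub>obj X n\<^esub> x = boundaries X n)"
    using image_eq_singleton_iff[OF assms(1)] by (simp only:)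
  also have "\<dots> \<longleftrightarrow> (\<forall>x\<in>?S. x \<in> boundaries X n)" by (rule ball_cong[OF refl assms(2)])
  finally show ?thesis by blast
qed

section \<open>Nonvanishing of local cohomology and Ext as failure of exactness\<close>

context inj_complex
begin

text \<open>The annihilators increase with the level, so two torsion elements lie in a common
  one.\<close>

lemma torsion_subgroup: "additive_subgroup (torsion n) (obj I n)"
proof (intro additive_subgroup.intro E.N.M.add.subgroupI)
  note sub = additive_subgroup.a_closed[OF E.ann_subgroup[of n]]
    additive_subgroup.a_inv_closed[OF E.ann_subgroup[of n]]
    additive_subgroup.zero_closed[OF E.ann_subgroup[of n]]
  show "torsion n \<subseteq> carrier (obj I n)" using E.ann_carrier by (auto simp: torsion_def)
  have "\<zero>\<^bsub>obj I n\<^esub> \<in> torsion n" using sub(3) by (auto simp: torsion_def)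
  then show "torsion n \<noteq> {}" by blast
  show "\<ominus>\<^bsub>obj I n\<^esub> x \<in> torsion n" if "x \<in> torsion n" for x
    using that sub(2) unfolding torsion_def by blast
  fix x y assume "x \<in> torsion n" "y \<in> torsion n"
  then obtain p q where "x \<in> ann G (obj I n) p" "y \<in> ann G (obj I n) q" by (auto simp: torsion_def)
  then have "x \<in> ann G (obj I n) (max p q)" "y \<in> ann G (obj I n) (max p q)"
    using E.ann_mono by simp_all
  then show "x \<oplus>\<^bsub>obj I n\<^esub> y \<in> torsion n" using sub(1) by (auto simp: torsion_def)
qed

lemma socle_subgroup: "additive_subgroup (socle n) (obj I n)"
  unfolding socle_def by (rule E.ann_subgroup)

lemma torsion_gcomp: "x \<in> torsion n \<Longrightarrow> gcomp (obj I n) (hcomp (obj I n)) x j \<in> torsion n"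
  and socle_gcomp: "x \<in> socle n \<Longrightarrow> gcomp (obj I n) (hcomp (obj I n)) x j \<in> socle n"
  unfolding torsion_def socle_def using E.ann_gcomp by blast+

text \<open>The differential preserves degrees, so any primitive of a homogeneous element may be
  replaced by its component of degree \<open>j\<close>, which stays in \<open>A\<close> by
  \<open>comp\<close>.\<close>

lemma exact_at_iff:
  assumes sub: "additive_subgroup (A (n + 1)) (obj I (n + 1))"
    and comp: "\<And>x. x \<in> A (n + 1) \<Longrightarrow> gcomp (obj I (n + 1)) (hcomp (obj I (n + 1))) x j \<in> A (n + 1)"
  shows "exact_at A n j \<longleftrightarrow> (\<forall>z\<in>hcomp (obj I n) j \<inter> A n. diff I n z = \<zero>\<^bsub>obj I (n - 1)\<^esub> \<longrightarrow>
    z \<in> diff I (n + 1) ` A (n + 1))"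
proof -
  have "\<exists>w\<in>hcomp (obj I (n + 1)) j \<inter> A (n + 1). diff I (n + 1) w = z"
    if z: "z \<in> hcomp (obj I n) j" and w: "w \<in> A (n + 1)" "z = diff I (n + 1) w" for z w
  proof -
    have wc: "w \<in> carrier (obj I (n + 1))" using additive_subgroup.a_Hcarr[OF sub w(1)] .
    have "diff I (n + 1) (gcomp (obj I (n + 1)) (hcomp (obj I (n + 1))) w j) =
        gcomp (obj I n) (hcomp (obj I n)) z j"
      using diff_gcomp[OF wc, of j] w(2) by simp
    also have "\<dots> = z" using E.N.gcomp_homogeneous[OF z, of j] by simp
    finally show ?thesis using comp[OF w(1)] E.N.gcomp_in[OF wc] by blast
  qed
  then show ?thesis unfolding exact_at_def by blast
qed

lemma boundary_coset_iff:
  assumes sub: "additive_subgroup A (obj I (n + 1))" and x: "x \<in> carrier (obj I n)"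
  shows "(diff I (n + 1) ` A) +>\<^bsub>obj I n\<^esub> x = diff I (n + 1) ` A \<longleftrightarrow> x \<in> diff I (n + 1) ` A"
    (is "?B +>\<^bsub>_\<^esub> x = ?B \<longleftrightarrow> _")
proof -
  interpret A: additive_subgroup A "obj I (n + 1)" by fact
  have carr: "a \<in> carrier (obj I (n + 1))" if "a \<in> A" for a using A.a_Hcarr[OF that] .
  have add: "b \<oplus>\<^bsub>obj I n\<^esub> c \<in> ?B" if bc: "b \<in> ?B" "c \<in> ?B" for b c
  proof -
    obtain a a' where "a \<in> A" "a' \<in> A" "b = diff I (n + 1) a" "c = diff I (n + 1) a'"
      using bc by blast
    then have "b \<oplus>\<^bsub>obj I n\<^esub> c = diff I (n + 1) (a \<oplus>\<^bsub>obj I (n + 1)\<^esub> a')"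
      using diff_add[of a "n + 1" a'] carr by simp
    then show ?thesis using A.a_closed \<open>a \<in> A\<close> \<open>a' \<in> A\<close> by blast
  qed
  have minus: "\<ominus>\<^bsub>obj I n\<^esub> b \<in> ?B" if b: "b \<in> ?B" for b
  proof -
    obtain a where "a \<in> A" "b = diff I (n + 1) a" using b by blast
    then have "\<ominus>\<^bsub>obj I n\<^esub> b = diff I (n + 1) (\<ominus>\<^bsub>obj I (n + 1)\<^esub> a)"
      using diff_minus[of a "n + 1"] carr by simp
    moreover have "\<ominus>\<^bsub>obj I (n + 1)\<^esub> a \<in> A"
      using A.a_inv_closed[OF \<open>a \<in> A\<close>] .
    ultimately show ?thesis by blast
  qed
  have zero: "\<zero>\<^bsub>obj I n\<^esub> \<in> ?B" using diff_zero[of "n + 1"] imageI[OF A.zero_closed, of "diff I (n + 1)"] by simp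
  have Bc: "b \<in> carrier (obj I n)" if "b \<in> ?B" for b using that carr diff_Suc(1) by blast
  show ?thesis
  proof
    assume "?B +>\<^bsub>obj I n\<^esub> x = ?B"
    moreover have "\<zero>\<^bsub>obj I n\<^esub> \<oplus>\<^bsub>obj I n\<^esub> x \<in> ?B +>\<^bsub>obj I n\<^esub> x"
      unfolding a_r_coset_def' using zero by blast
    ultimately show "x \<in> ?B" using x by simp
  next
    assume xB: "x \<in> ?B"
    have "b \<in> ?B +>\<^bsub>obj I n\<^esub> x" if "b \<in> ?B" for b
    proof -
      have "b = (b \<oplus>\<^bsub>obj I n\<^esub> \<ominus>\<^bsub>obj I n\<^esub> x) \<oplus>\<^bsub>obj I n\<^esub> x"
        using Bc[OF that] x by (simp add: E.N.M.a_assoc E.N.M.l_neg)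
      then show ?thesis
        unfolding a_r_coset_def' using add[OF that minus[OF xB]] by blast
    qed
    then show "?B +>\<^bsub>obj I n\<^esub> x = ?B" using add xB unfolding a_r_coset_def' by blast
  qed
qed

text \<open>Cohomological degree \<open>i\<close> is homological index \<open>- i\<close>. The
  torsion complex inherits its differential from \<open>I\<close>, so its cycles and boundaries are
  those taken within \<open>torsion\<close>.\<close>

lemma local_cohomology_nonzero_iff:
  "hcomp (local_cohomology R G I i) j \<noteq> {\<zero>\<^bsub>local_cohomology R G I i\<^esub>} \<longleftrightarrow>
    \<not> exact_at torsion (- i) j"
proof -
  define n where "n = - i"
  have exact: "exact_at torsion n j \<longleftrightarrow> (\<forall>z\<in>hcomp (obj I n) j \<inter> torsion n.
      diff I n z = \<zero>\<^bsub>obj I (n - 1)\<^esub> \<longrightarrow> z \<in> diff I (n + 1) ` torsion (n + 1))"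
    by (rule exact_at_iff) (rule torsion_subgroup, rule torsion_gcomp)
  let ?X = "Gamma_complex R G I"
  have obj: "obj ?X m = torsion_submodule R G (obj I m)" for m by (simp add: Gamma_complex_def)
  have B: "boundaries ?X n = diff I (n + 1) ` torsion (n + 1)"
    by (simp add: boundaries_def obj E.torsion_carrier torsion_def) (simp add: Gamma_complex_def)
  have Z: "hcomp (obj ?X n) j \<inter> cycles ?X n =
      {z \<in> hcomp (obj I n) j \<inter> torsion n. diff I n z = \<zero>\<^bsub>obj I (n - 1)\<^esub>}"
    by (auto simp: cycles_def obj E.torsion_carrier torsion_def) (auto simp: Gamma_complex_def)
  have coset: "H +>\<^bsub>obj ?X n\<^esub> x = H +>\<^bsub>obj I n\<^esub> x" for H x
    by (simp add: obj a_r_coset_def')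
  have "\<zero>\<^bsub>obj I n\<^esub> \<in> hcomp (obj ?X n) j \<inter> cycles ?X n"
    unfolding Z using E.N.component_zero diff_zero additive_subgroup.zero_closed[OF torsion_subgroup]
    by simp
  then have "hcomp (obj ?X n) j \<inter> cycles ?X n \<noteq> {}" by blast
  then have "hcomp (homology ?X n) j \<noteq> {\<zero>\<^bsub>homology ?X n\<^esub>} \<longleftrightarrow>
      (\<exists>x\<in>hcomp (obj ?X n) j \<inter> cycles ?X n. x \<notin> boundaries ?X n)"
  proof (rule homology_hcomp_nonzero_iff)
    fix x assume "x \<in> hcomp (obj ?X n) j \<inter> cycles ?X n"
    then have "x \<in> carrier (obj I n)" unfolding Z using E.N.component_carrier by blast
    then show "boundaries ?X n +>\<^bsub>obj ?X n\<^esub> x = boundaries ?X n \<longleftrightarrow> x \<in> boundaries ?X n"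
      unfolding B coset by (rule boundary_coset_iff[OF torsion_subgroup])
  qed
  also have "\<dots> \<longleftrightarrow> \<not> exact_at torsion n j"
    unfolding exact Z B by blast
  finally show ?thesis by (simp add: local_cohomology_def n_def)
qed

abbreviation soc :: "int \<Rightarrow> 'e \<Rightarrow> 'r set \<Rightarrow> 'e" where
  "soc n \<equiv> std_graded_module.soc_map R G (obj I n)"

text \<open>This makes \<open>soc\<close> a chain map from the socle subcomplex to
  \<open>Hom_complex\<close>.\<close>

lemma diff_soc:
  assumes "s \<in> socle n"
  shows "(\<lambda>x\<in>carrier \<kappa>. diff I n (soc n s x)) = soc (n - 1) (diff I n s)"
proof (rule E.eq_soc_map)
  show "diff I n s \<in> ann G (obj I (n - 1)) 1" using diff_ann assms by (simp add: socle_def)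
  fix r assume "r \<in> carrier R"
  then show "(\<lambda>x\<in>carrier \<kappa>. diff I n (soc n s x)) (cls r) = r \<odot>\<^bsub>obj I (n - 1)\<^esub> diff I n s"
    using assms E.soc_map_cls diff_smult E.ann_carrier
    by (simp add: socle_def residue_field_carrier)
qed simp

lemma soc_inj: "inj_on (soc n) (socle n)"
  by (rule inj_on_inverseI[of _ "\<lambda>f. f (cls \<one>)"]) (simp only: socle_def E.soc_map_one)

text \<open>The maps \<open>soc n\<close> identify the socle subcomplex with
  \<open>Hom_complex\<close>, so homogeneous cycles, boundaries and cosets of the latter are images
  under \<open>soc n\<close>. Injectivity lets the question be decided in the socle.\<close>

lemma Ext_nonzero_iff:
  "hcomp (Ext R \<kappa> I i) j \<noteq> {\<zero>\<^bsub>Ext R \<kappa> I i\<^esub>} \<longleftrightarrow> \<not> exact_at socle (- i) j"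
proof -
  define n where "n = - i"
  have exact: "exact_at socle n j \<longleftrightarrow> (\<forall>z\<in>hcomp (obj I n) j \<inter> socle n.
      diff I n z = \<zero>\<^bsub>obj I (n - 1)\<^esub> \<longrightarrow> z \<in> diff I (n + 1) ` socle (n + 1))"
    by (rule exact_at_iff) (rule socle_subgroup, rule socle_gcomp)
  let ?X = "Hom_complex R \<kappa> I"
  let ?D = "diff I (n + 1) ` socle (n + 1)"
  have obj: "obj ?X m = graded_Hom R \<kappa> (obj I m)" for m by (simp add: Hom_complex_def)
  have diff: "diff ?X m (soc m s) = soc (m - 1) (diff I m s)" if "s \<in> socle m" for m s
    using diff_soc[OF that] by (simp add: Hom_complex_def)
  have carr: "carrier (obj ?X m) = soc m ` socle m" for m
    by (simp add: obj E.graded_Hom_carrier socle_def)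
  have D: "?D \<subseteq> socle n"
  proof
    fix x assume "x \<in> ?D"
    then obtain s where "s \<in> socle (n + 1)" "x = diff I (n + 1) s" by blast
    then show "x \<in> socle n" using diff_ann[of s "n + 1" 1] by (simp add: socle_def)
  qed
  have B: "boundaries ?X n = soc n ` ?D"
  proof -
    have "boundaries ?X n = (\<lambda>s. diff ?X (n + 1) (soc (n + 1) s)) ` socle (n + 1)"
      by (simp add: boundaries_def carr image_image)
    also have "\<dots> = (\<lambda>s. soc n (diff I (n + 1) s)) ` socle (n + 1)"
      by (rule image_cong[OF refl]) (use diff[of _ "n + 1"] in simp)
    finally show ?thesis by (simp add: image_image)
  qed
  have zero: "\<zero>\<^bsub>obj I m\<^esub> \<in> socle m" for m using additive_subgroup.zero_closed[OF socle_subgroup] .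
  have dsoc: "diff I n z \<in> socle (n - 1)" if "z \<in> socle n" for z
    using diff_ann that by (simp add: socle_def)
  have cyc: "soc (n - 1) (diff I n z) = soc (n - 1) \<zero>\<^bsub>obj I (n - 1)\<^esub> \<longleftrightarrow>
      diff I n z = \<zero>\<^bsub>obj I (n - 1)\<^esub>" if "z \<in> socle n" for z
    using inj_on_eq_iff[OF soc_inj dsoc[OF that] zero] .
  have H: "hcomp (obj ?X n) j = soc n ` (socle n \<inter> hcomp (obj I n) j)"
    by (simp add: obj E.graded_Hom_hcomp socle_def)
  have Z: "hcomp (obj ?X n) j \<inter> cycles ?X n =
      soc n ` {z \<in> hcomp (obj I n) j \<inter> socle n. diff I n z = \<zero>\<^bsub>obj I (n - 1)\<^esub>}"
  proof -
    have "\<zero>\<^bsub>obj ?X (n - 1)\<^esub> = soc (n - 1) \<zero>\<^bsub>obj I (n - 1)\<^esub>" by (simp add: obj E.graded_Hom_zero)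
    then have "soc n z \<in> cycles ?X n \<longleftrightarrow> diff I n z = \<zero>\<^bsub>obj I (n - 1)\<^esub>" if "z \<in> socle n" for z
      using that diff[OF that] cyc[OF that] by (simp add: cycles_def carr)
    then show ?thesis unfolding H by blast
  qed
  have mem: "soc n z \<in> soc n ` ?D \<longleftrightarrow> z \<in> ?D" if "z \<in> socle n" for z
    using inj_on_image_mem_iff[OF soc_inj that D] .
  have coset: "(soc n ` ?D) +>\<^bsub>obj ?X n\<^esub> soc n z = soc n ` (?D +>\<^bsub>obj I n\<^esub> z)" if "z \<in> socle n" for z
  proof -
    have "soc n d \<oplus>\<^bsub>obj ?X n\<^esub> soc n z = soc n (d \<oplus>\<^bsub>obj I n\<^esub> z)" if "d \<in> ?D" for d
      using E.soc_map_add[of d n z] subsetD[OF D that] \<open>z \<in> socle n\<close> by (simp add: obj socle_def)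
    then show ?thesis unfolding a_r_coset_def' by auto
  qed
  have co: "(soc n ` ?D) +>\<^bsub>obj ?X n\<^esub> soc n z = soc n ` ?D \<longleftrightarrow> soc n z \<in> soc n ` ?D"
    if z: "z \<in> socle n" for z
  proof -
    \<comment> \<open>Injectivity of \<open>soc n\<close> is available on the socle, so both sets to
      be compared have to lie there.\<close>
    have "?D +>\<^bsub>obj I n\<^esub> z \<subseteq> socle n"
      using additive_subgroup.a_closed[OF socle_subgroup _ z] D unfolding a_r_coset_def' by blast
    then have "soc n ` (?D +>\<^bsub>obj I n\<^esub> z) = soc n ` ?D \<longleftrightarrow> ?D +>\<^bsub>obj I n\<^esub> z = ?D"
      using inj_on_image_eq_iff[OF soc_inj _ D] by blast
    then show ?thesis
      using coset[OF z] mem[OF z] boundary_coset_iff[OF socle_subgroup, of z n]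
        additive_subgroup.a_Hcarr[OF socle_subgroup z] by simp
  qed
  have "soc n \<zero>\<^bsub>obj I n\<^esub> \<in> hcomp (obj ?X n) j \<inter> cycles ?X n"
    unfolding Z using E.N.component_zero diff_zero zero by blast
  then have "hcomp (obj ?X n) j \<inter> cycles ?X n \<noteq> {}" by blast
  then have "hcomp (homology ?X n) j \<noteq> {\<zero>\<^bsub>homology ?X n\<^esub>} \<longleftrightarrow>
      (\<exists>x\<in>hcomp (obj ?X n) j \<inter> cycles ?X n. x \<notin> boundaries ?X n)"
  proof (rule homology_hcomp_nonzero_iff)
    fix x assume "x \<in> hcomp (obj ?X n) j \<inter> cycles ?X n"
    then obtain z where "z \<in> socle n" "x = soc n z" unfolding Z by blast
    then show "boundaries ?X n +>\<^bsub>obj ?X n\<^esub> x = boundaries ?X n \<longleftrightarrow> x \<in> boundaries ?X n"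
      unfolding B using co by simp
  qed
  also have "\<dots> \<longleftrightarrow> \<not> exact_at socle n j"
    unfolding exact Z B using mem by auto
  finally show ?thesis by (simp add: Ext_def n_def)
qed

end

section \<open>Comparison of the two suprema\<close>

theorem theorem3p9:
  fixes k :: "'r set" and R :: "'r ring" and G :: "nat \<Rightarrow> 'r set"
    and M :: "('r, 'm) gcomplex" and I :: "('r, 'e) gcomplex" and \<eta> :: "int \<Rightarrow> 'm \<Rightarrow> 'e"
  assumes "standard_graded_algebra k R G"
    and "M \<in> Dfb R G"
    and "injective_resolution R G M I \<eta>"
  shows "reg R G I = exreg R G I"
proof -
  interpret inj_complex R k G I
  proof (intro inj_complex.intro std_graded.intro std_graded_axioms.intro inj_complex_axioms.intro)
    show "cring R" using assms(1) by (simp add: standard_graded_algebra_def)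
  qed (use assms in \<open>simp_all add: injective_resolution_def\<close>)
  obtain b where b: "\<And>n. b < n \<Longrightarrow> carrier (obj I n) = {\<zero>\<^bsub>obj I n\<^esub>}"
    using assms(3) by (auto simp: injective_resolution_def)
  \<comment> \<open>By contraposition with threshold \<open>i + j - 1\<close>: over the integers,
    total degree \<open>l - n\<close> strictly above it means at least \<open>i + j\<close>, so
    exactness of the socle there would give exactness of the torsion at the given spot.\<close>
  have 1: "\<exists>i' j'. i + j \<le> i' + j' \<and> \<not> exact_at socle (- i') j'" 
    if neg: "\<not> exact_at torsion (- i) j" for i j
  proof (rule ccontr)
    assume none: "\<not> ?thesis"
    have "exact_at socle n l" if "i + j - 1 < l - n" for n l
    proof (rule ccontr)
      assume "\<not> exact_at socle n l"
      with that have "i + j \<le> - n + l \<and> \<not> exact_at socle (- (- n)) l" by simp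
      then show False using none by blast
    qed
    then show False using torsion_exact_if_socle_exact[of "i + j - 1" j "- i"] neg by simp
  qed
  have 2: "\<exists>i' j'. i + j \<le> i' + j' \<and> \<not> exact_at torsion (- i') j'" 
    if neg: "\<not> exact_at socle (- i) j" for i j
  proof (rule ccontr)
    assume none: "\<not> ?thesis"
    have "exact_at torsion n l" if "i + j - 1 < l - n" for n l
    proof (rule ccontr)
      assume "\<not> exact_at torsion n l"
      with that have "i + j \<le> - n + l \<and> \<not> exact_at torsion (- (- n)) l" by simp
      then show False using none by blast
    qed
    then show False using socle_exact_if_torsion_exact[OF b, where r = "i + j - 1" and j = j and n = "- i"] neg by simp
  qed
  have "reg R G I \<le> exreg R G I"
    unfolding reg_def exreg_def local_cohomology_nonzero_iff Ext_nonzero_iff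
  \<comment> \<open>Every element of one set is dominated by an element of the other; this compares
    the suprema also when a set is empty or unbounded.\<close>
  proof (rule Sup_mono, clarify)
    fix i j assume "\<not> exact_at torsion (- i) j"
    from 1[OF this] show "\<exists>y\<in>{ereal (of_int (i + j)) |i j. \<not> exact_at socle (- i) j}.
        ereal (of_int (i + j)) \<le> y" by (force simp flip: of_int_add)
  qed
  moreover have "exreg R G I \<le> reg R G I"
    unfolding reg_def exreg_def local_cohomology_nonzero_iff Ext_nonzero_iff
  proof (rule Sup_mono, clarify)
    fix i j assume "\<not> exact_at socle (- i) j"
    from 2[OF this] show "\<exists>y\<in>{ereal (of_int (i + j)) |i j. \<not> exact_at torsion (- i) j}.
        ereal (of_int (i + j)) \<le> y" by (force simp flip: of_int_add)
  qed
  ultimately show ?thesis by (rule antisym)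
qed

end
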